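(* Let $n,k\geq1$. If $X\subseteq\mathbb{N}$ is finite, $\omega^{kn}\cdot4$-large and $(x\mapsto x^{R_x(2x+2)})$-sparse with $kn\leq\min X$, then for every coloring $f:[X]^2\to\{0,\dots,k-1\}$ there is an $\omega^n$-large $f$-homogeneous subset of $X$.
   Context: $H$ is $f$-homogeneous if $f$ is constant on $[H]^2$. $R_k(d)$ is the least $R$ such that every $f:[\{0,\dots,R-1\}]^2\to k$ admits a homogeneous set of size $d$. For $g:\mathbb{N}\to\mathbb{N}$, $X$ is $g$-sparse if $y>g(x)$ for all $x<y$ in $X$. Fundamental sequences: $\{0\}(x)=0$; for $\alpha\neq0$ write $\alpha=\delta+\omega^\gamma$ in Cantor normal form with $\omega^\gamma$ the last term; $\{\alpha\}(x)=\delta$ if $\gamma=0$, $\delta+\omega^{\gamma'}\cdot x$ if $\gamma=\gamma'+1$, $\delta+\omega^{\{\gamma\}(x)}$ if $\gamma$ is a limit. For finite $X=\{x_0<\dots<x_s\}$, $\{\alpha\}(X)=\{\cdots\{\{\alpha\}(x_0)\}(x_1)\cdots\}(x_s)$ and $X$ is $\alpha$-large iff $\{\alpha\}(X)=0$. *)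

theory Defs
  imports "HOL-Library.Ramsey"
begin

text \<open>
  Ordinals below \<open>\<epsilon>\<^sub>0\<close> as Cantor normal form terms.  The exponents are listed with the
  \<^emph>\<open>last\<close> (smallest) term first: \<open>CNF [\<gamma>\<^sub>0, \<gamma>\<^sub>1, \<dots>, \<gamma>\<^sub>m]\<close> stands for
  \<open>\<omega>\<^bsup>\<gamma>\<^sub>m\<^esup> + \<dots> + \<omega>\<^bsup>\<gamma>\<^sub>1\<^esup> + \<omega>\<^bsup>\<gamma>\<^sub>0\<^esup>\<close>, and \<open>CNF []\<close> is \<open>0\<close>.  So \<open>CNF (\<gamma> # \<delta>)\<close> is
  \<open>\<delta> + \<omega>\<^bsup>\<gamma>\<^esup>\<close>; it is a successor iff \<open>\<gamma> = CNF []\<close>, and then its predecessor is \<open>CNF \<delta>\<close>.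
\<close>

datatype cnf = CNF "cnf list"

text \<open>The ordering of ordinals: common leading terms form a common suffix of the lists.\<close>

inductive cnf_less :: "cnf \<Rightarrow> cnf \<Rightarrow> bool" where
  extend: "cs \<noteq> [] \<Longrightarrow> cnf_less (CNF as) (CNF (cs @ as))"
| differ: "cnf_less a b \<Longrightarrow> cnf_less (CNF (cs @ a # as)) (CNF (ds @ b # as))"

fun is_cnf :: "cnf \<Rightarrow> bool" where
  "is_cnf (CNF as) \<longleftrightarrow> (\<forall>a\<in>set as. is_cnf a) \<and> sorted_wrt (\<lambda>a b. cnf_less a b \<or> a = b) as"

definition omega_pow_times :: "cnf \<Rightarrow> nat \<Rightarrow> cnf" where
  "omega_pow_times \<gamma> m = CNF (replicate m \<gamma>)"

definition cnf_of_nat :: "nat \<Rightarrow> cnf" where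
  "cnf_of_nat m = omega_pow_times (CNF []) m"

text \<open>
  Fundamental sequences.  The clauses treat \<open>0\<close> and \<open>\<delta> + \<omega>\<^bsup>\<gamma>\<^esup>\<close> with \<open>\<gamma> = 0\<close>,
  \<open>\<gamma> = \<gamma>' + 1\<close> and \<open>\<gamma>\<close> a limit, in this order.
\<close>

fun fund :: "cnf \<Rightarrow> nat \<Rightarrow> cnf" where
  "fund (CNF []) x = CNF []"
| "fund (CNF (CNF [] # \<delta>)) x = CNF \<delta>"
| "fund (CNF (CNF (CNF [] # \<gamma>') # \<delta>)) x = CNF (replicate x (CNF \<gamma>') @ \<delta>)"
| "fund (CNF (CNF (CNF (e # es) # \<gamma>) # \<delta>)) x = CNF (fund (CNF (CNF (e # es) # \<gamma>)) x # \<delta>)"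

lemma append_eq_append_Cons:
  "cs @ as = cs' @ b # es \<Longrightarrow>
    (\<exists>us. cs = cs' @ b # us \<and> us @ as = es) \<or> (\<exists>us. as = us @ b # es)"
proof (induction cs arbitrary: cs')
  case (Cons c cs)
  then show ?case by (cases cs') auto
qed simp

lemma cnf_less_trans: "cnf_less a b \<Longrightarrow> cnf_less b c \<Longrightarrow> cnf_less a c"
proof (induction b arbitrary: a c)
  case (CNF bs)
  from CNF.prems(1) show ?case
  proof cases
    case 1: (extend cs as)
    from CNF.prems(2) show ?thesis
    proof cases
      case (extend cs')
      then show ?thesis using 1 cnf_less.extend[of "cs' @ cs" as] by simp
    next
      case 2: (differ b' c' cs' es ds')
      from 1 2 have "cs @ as = cs' @ b' # es" by simp
      then consider us where "cs = cs' @ b' # us" "us @ as = es"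
        | us where "as = us @ b' # es"
        by (blast dest: append_eq_append_Cons)
      then show ?thesis
      proof cases
        case (1 us)
        then show ?thesis using \<open>a = CNF as\<close> 2 cnf_less.extend[of "ds' @ c' # us" as] by simp
      next
        case (2 us)
        then show ?thesis using \<open>a = CNF as\<close> \<open>c = CNF (ds' @ c' # es)\<close> \<open>cnf_less b' c'\<close>
          by (simp add: cnf_less.differ)
      qed
    qed
  next
    case 1: (differ a' b' cs es ds)
    from CNF.prems(2) show ?thesis
    proof cases
      case (extend cs')
      then show ?thesis using 1 cnf_less.differ[of a' b' cs es "cs' @ ds"] by simp
    next
      case 2: (differ b'' c' cs' es' ds')
      from 1 2 have *: "bs = ds @ b' # es" "ds @ b' # es = cs' @ b'' # es'" by simp_all
      then consider "b' = b''" "es = es'" | us where "es = us @ b'' # es'"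
        | us where "es' = us @ b' # es"
        using append_eq_append_Cons[OF *(2)] by (auto simp: Cons_eq_append_conv)
      then show ?thesis
      proof cases
        case 1
        then have "cnf_less a' c'" using CNF.IH[of b' a' c'] * 2 \<open>cnf_less a' b'\<close> by auto
        then show ?thesis using 1 \<open>a = _\<close> 2 by (simp add: cnf_less.differ)
      next
        case (2 us)
        then show ?thesis
          using \<open>a = _\<close> \<open>c = _\<close> \<open>cnf_less b'' c'\<close> cnf_less.differ[of b'' c' "cs @ a' # us" es' ds']
          by simp
      next
        case (3 us)
        then show ?thesis
          using \<open>a = _\<close> \<open>c = _\<close> \<open>cnf_less a' b'\<close> cnf_less.differ[of a' b' cs es "ds' @ c' # us"]
          by simp
      qed
    qed
  qed
qed

lemma fund_less: "\<alpha> \<noteq> CNF [] \<Longrightarrow> cnf_less (fund \<alpha> x) \<alpha>"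
proof (induction \<alpha> x rule: fund.induct)
  case (2 \<delta> x)
  show ?case using cnf_less.extend[of "[CNF []]" \<delta>] by simp
next
  case (3 \<gamma>' \<delta> x)
  show ?case
  proof (cases x)
    case 0
    then show ?thesis using cnf_less.extend[of "[CNF (CNF [] # \<gamma>')]" \<delta>] by simp
  next
    case (Suc m)
    have "cnf_less (CNF \<gamma>') (CNF (CNF [] # \<gamma>'))"
      using cnf_less.extend[of "[CNF []]" \<gamma>'] by simp
    from cnf_less.differ[OF this, of "replicate m (CNF \<gamma>')" \<delta> "[]"]
    show ?thesis using Suc by (simp add: replicate_app_Cons_same)
  qed
next
  case (4 e es \<gamma> \<delta> x)
  then show ?case using cnf_less.differ[of _ _ "[]" \<delta> "[]"] by simp
qed simp

lemma is_cnf_fund: "is_cnf \<alpha> \<Longrightarrow> is_cnf (fund \<alpha> x)"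
proof (induction \<alpha> x rule: fund.induct)
  case (2 \<delta> x)
  then show ?case by simp
next
  case (3 \<gamma>' \<delta> x)
  have lt: "cnf_less (CNF \<gamma>') (CNF (CNF [] # \<gamma>'))"
    using cnf_less.extend[of "[CNF []]" \<gamma>'] by simp
  from 3 have \<delta>: "is_cnf (CNF (CNF [] # \<gamma>'))" "\<forall>a\<in>set \<delta>. is_cnf a"
    "sorted_wrt (\<lambda>a b. cnf_less a b \<or> a = b) \<delta>"
    "\<forall>a\<in>set \<delta>. cnf_less (CNF (CNF [] # \<gamma>')) a \<or> CNF (CNF [] # \<gamma>') = a"
    by auto
  from \<delta>(1) have "is_cnf (CNF \<gamma>')" by simp
  moreover have "\<forall>a\<in>set \<delta>. cnf_less (CNF \<gamma>') a"
    using \<delta>(4) lt cnf_less_trans by blast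
  moreover have "sorted_wrt (\<lambda>a b. cnf_less a b \<or> a = b) (replicate x (CNF \<gamma>'))"
    by (induction x) auto
  ultimately show ?case using \<delta>(2,3)
    by (auto simp: sorted_wrt_append)
next
  case (4 e es \<gamma> \<delta> x)
  let ?\<gamma> = "CNF (CNF (e # es) # \<gamma>)"
  from "4.prems" have \<delta>: "is_cnf ?\<gamma>" "\<forall>a\<in>set \<delta>. is_cnf a"
    "sorted_wrt (\<lambda>a b. cnf_less a b \<or> a = b) \<delta>"
    "\<forall>a\<in>set \<delta>. cnf_less ?\<gamma> a \<or> ?\<gamma> = a"
    by auto
  have "\<forall>a\<in>set \<delta>. cnf_less (fund ?\<gamma> x) a"
    using \<delta>(4) fund_less[of ?\<gamma> x] cnf_less_trans by blast
  then show ?case using \<delta> "4.IH" by auto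
qed simp

lemma is_cnf_omega_pow_times: "is_cnf \<gamma> \<Longrightarrow> is_cnf (omega_pow_times \<gamma> m)"
proof -
  have "sorted_wrt (\<lambda>a b. cnf_less a b \<or> a = b) (replicate m \<gamma>)"
    by (induction m) auto
  then show "is_cnf \<gamma> \<Longrightarrow> ?thesis"
    by (auto simp: omega_pow_times_def)
qed

lemma is_cnf_of_nat: "is_cnf (cnf_of_nat m)"
  unfolding cnf_of_nat_def by (intro is_cnf_omega_pow_times) simp

definition fund_set :: "cnf \<Rightarrow> nat set \<Rightarrow> cnf" where
  "fund_set \<alpha> X = foldl fund \<alpha> (sorted_list_of_set X)"

definition large :: "cnf \<Rightarrow> nat set \<Rightarrow> bool" where
  "large \<alpha> X \<longleftrightarrow> finite X \<and> fund_set \<alpha> X = CNF []"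

definition sparse :: "(nat \<Rightarrow> nat) \<Rightarrow> nat set \<Rightarrow> bool" where
  "sparse g X \<longleftrightarrow> (\<forall>x\<in>X. \<forall>y\<in>X. x < y \<longrightarrow> g x < y)"

definition homogeneous :: "('a set \<Rightarrow> 'b) \<Rightarrow> 'a set \<Rightarrow> bool" where
  "homogeneous f H \<longleftrightarrow> (\<exists>c. \<forall>e\<in>[H]\<^bsup>2\<^esup>. f e = c)"

definition ramsey_number :: "nat \<Rightarrow> nat \<Rightarrow> nat" where
  "ramsey_number k d = (LEAST R. \<forall>f\<in>[{..<R}]\<^bsup>2\<^esup> \<rightarrow> {..<k}. \<exists>H\<subseteq>{..<R}. card H = d \<and> homogeneous f H)"

text \<open>The \<open>LEAST\<close> above is taken over a nonempty set.\<close>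

lemma ramsey_number_exists:
  "\<exists>R. \<forall>f\<in>[{..<R::nat}]\<^bsup>2\<^esup> \<rightarrow> {..<k::nat}. \<exists>H\<subseteq>{..<R}. card H = d \<and> homogeneous f H"
proof -
  obtain N :: nat where N: "partn_lst {..<N} (replicate k d) 2"
    using ramsey_full by blast
  have "\<exists>H\<subseteq>{..<N}. card H = d \<and> homogeneous f H" if f: "f \<in> [{..<N}]\<^bsup>2\<^esup> \<rightarrow> {..<k}" for f
  proof -
    obtain i H where "i < k" "H \<in> [{..<N}]\<^bsup>(replicate k d ! i)\<^esup>" "f ` [H]\<^bsup>2\<^esup> \<subseteq> {i}"
      using partn_lstE[OF N f] by auto
    then have "H \<subseteq> {..<N}" "card H = d" "\<forall>e\<in>[H]\<^bsup>2\<^esup>. f e = i"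
      by (auto simp: nsets_def)
    then show ?thesis unfolding homogeneous_def by blast
  qed
  then show ?thesis by blast
qed

end

theory Submission
  imports Defs
begin

text \<open>
  Assign to each colour \<open>i < k\<close> its own target \<open>\<omega>\<^bsup>b i\<^esup> \<cdot> m i\<close>, and show by induction on
  \<open>s = \<Sum>i<k. b i\<close> that a sparse set containing a Ramsey number of consecutive \<open>\<omega>\<^sup>s\<close>-large blocks has a
  homogeneous set meeting the target of its colour.  Sparsity allows to thin out the blocks so that
  the colour of a pair from two different blocks depends on the blocks only, at the price of
  replacing the \<open>\<omega>\<^sup>s\<close>-large blocks by \<open>\<omega>\<^bsup>s-1\<^esup> \<cdot> N\<close>-large ones, with \<open>N\<close> huge compared to everything
  before the block.  By Ramsey's theorem many blocks have the same colour \<open>c\<close> between them.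
  Inside each of them the induction hypothesis applies to the same targets with \<open>b c\<close> lowered by
  one, and the pieces of colour \<open>c\<close> so obtained add up to a set meeting the old target.  The
  theorem starts from a point \<open>x\<close> with constant colour \<open>c\<close> to the rest, and the targets
  \<open>\<omega>\<^bsup>n-1\<^esup> \<cdot> x\<close> for \<open>c\<close> and \<open>\<omega>\<^sup>n\<close> for the other colours.
\<close>

section \<open>Largeness below \<open>\<omega>\<^sup>\<omega>\<close>\<close>

text \<open>\<open>pow_large s m X\<close>: the set \<open>X\<close> has an \<open>\<omega>\<^sup>s \<cdot> m\<close>-large subset.\<close>

fun pow_large :: "nat \<Rightarrow> nat \<Rightarrow> nat set \<Rightarrow> bool" where
  "pow_large 0 m X \<longleftrightarrow> m \<le> card X"
| "pow_large (Suc s) 0 X \<longleftrightarrow> True"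
| "pow_large (Suc s) (Suc m) X \<longleftrightarrow>
    (\<exists>x\<in>X. \<exists>Y\<subseteq>X. \<exists>Z\<subseteq>X. (\<forall>y\<in>Y. x < y) \<and> (\<forall>z\<in>Z. x < z) \<and> (\<forall>y\<in>Y. \<forall>z\<in>Z. y < z) \<and>
      pow_large s x Y \<and> pow_large (Suc s) m Z)"

lemma pow_large_0 [simp]: "pow_large s 0 X"
  by (cases s) auto

text \<open>Only the cardinality clause at exponent 0 looks at the whole set; there finiteness keeps
  \<open>card X'\<close> from being 0 by convention. For positive exponents the same witnesses
  serve.\<close>

lemma pow_large_superset:
  assumes "pow_large s m X" "X \<subseteq> X'" "finite X'"
  shows "pow_large s m X'"
proof (cases s)
  case 0
  then show ?thesis using assms card_mono[of X' X] by auto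
next
  case s: (Suc s')
  show ?thesis
  proof (cases m)
    case (Suc m')
    with s assms(1) obtain x Y Z where "x \<in> X" "Y \<subseteq> X" "Z \<subseteq> X" "\<forall>y\<in>Y. x < y" "\<forall>z\<in>Z. x < z"
      "\<forall>y\<in>Y. \<forall>z\<in>Z. y < z" "pow_large s' x Y" "pow_large s m' Z"
      using pow_large.simps(3)[of s' m' X] by blast
    then show ?thesis
      unfolding s Suc pow_large.simps(3)
      using assms(2) by (intro bexI[of _ x] exI[of _ Y] exI[of _ Z] conjI) auto
  qed simp
qed

text \<open>Giving up one copy frees a point \<open>u\<close> above all the others. At exponent 0
  this is the maximum; otherwise the first opening point and its block stay, and the induction on
  \<open>m\<close> finds \<open>u\<close> in the tail \<open>Z\<close>.\<close>

lemma pow_large_less: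
  assumes "pow_large s (Suc m) X"
  shows "\<exists>u\<in>X. pow_large s m (X \<inter> {..<u})"
proof (cases s)
  case 0
  with assms have "finite X" "X \<noteq> {}" by (auto intro: card_ge_0_finite)
  moreover from this have "X \<inter> {..<Max X} = X - {Max X}"
    by (auto intro: le_neq_trans)
  ultimately show ?thesis using assms 0 by (intro bexI[of _ "Max X"]) auto
next
  case (Suc s')
  have "pow_large (Suc s') (Suc m) X \<Longrightarrow> \<exists>u\<in>X. pow_large (Suc s') m (X \<inter> {..<u})" for X
  proof (induction m arbitrary: X)
    case 0
    then show ?case by auto
  next
    case (Suc m)
    from Suc.prems obtain x Y Z where *: "x \<in> X" "Y \<subseteq> X" "Z \<subseteq> X" "\<forall>y\<in>Y. x < y"
      "\<forall>z\<in>Z. x < z" "\<forall>y\<in>Y. \<forall>z\<in>Z. y < z" "pow_large s' x Y" "pow_large (Suc s') (Suc m) Z"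
      using pow_large.simps(3)[of s' "Suc m" X] by blast
    from Suc.IH[OF *(8)] obtain u where u: "u \<in> Z" "pow_large (Suc s') m (Z \<inter> {..<u})"
      by blast
    have "pow_large (Suc s') (Suc m) (X \<inter> {..<u})"
      unfolding pow_large.simps(3)
      using * u by (intro bexI[of _ x] exI[of _ Y] exI[of _ "Z \<inter> {..<u}"] conjI) auto
    with u * show ?case by blast
  qed
  with assms Suc show ?thesis by blast
qed

lemma pow_large_pred: "pow_large s (Suc m) X \<Longrightarrow> finite X \<Longrightarrow> pow_large s m X"
  using pow_large_less[of s m X] by (auto intro: pow_large_superset)

lemma pow_large_mono:
  assumes "pow_large s m X" "m' \<le> m" "X \<subseteq> X'" "finite X'"
  shows "pow_large s m' X'"
proof -
  have "pow_large s m' X" using assms(2,1)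
    by (induction rule: inc_induct) (auto intro: pow_large_pred finite_subset[OF assms(3,4)])
  then show ?thesis using assms(3,4) by (rule pow_large_superset)
qed

lemma pow_large_nonempty: "pow_large s m X \<Longrightarrow> 0 < m \<Longrightarrow> X \<noteq> {}"
  using pow_large_less[of s "m - 1" X] by auto

text \<open>Unrolls the recursion into \<open>m\<close> consecutive blocks. The point
  \<open>e j\<close> both opens its block and counts the copies of \<open>\<omega>^s\<close> in
  \<open>F j\<close>, so lower bounds on \<open>e j\<close> obtained from sparsity become lower
  bounds on the size of the block.\<close>

lemma pow_large_blocks:
  assumes "pow_large (Suc s) m X"
  shows "\<exists>e F. (\<forall>j<m. e j \<in> X \<and> F j \<subseteq> X \<and> (\<forall>y\<in>F j. e j < y) \<and> pow_large s (e j) (F j)) \<and>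
    (\<forall>i j. i < j \<longrightarrow> j < m \<longrightarrow> e i < e j \<and> (\<forall>y\<in>F i. y < e j))"
  using assms
proof (induction m arbitrary: X)
  case 0
  then show ?case by auto
next
  case (Suc m)
  from Suc.prems obtain x Y Z where *: "x \<in> X" "Y \<subseteq> X" "Z \<subseteq> X" "\<forall>y\<in>Y. x < y"
    "\<forall>z\<in>Z. x < z" "\<forall>y\<in>Y. \<forall>z\<in>Z. y < z" "pow_large s x Y" "pow_large (Suc s) m Z"
    using pow_large.simps(3)[of s m X] by blast
  from Suc.IH[OF *(8)] obtain e F where
    eF: "\<And>j. j < m \<Longrightarrow> e j \<in> Z \<and> F j \<subseteq> Z \<and> (\<forall>y\<in>F j. e j < y) \<and> pow_large s (e j) (F j)"
      "\<And>i j. i < j \<Longrightarrow> j < m \<Longrightarrow> e i < e j \<and> (\<forall>y\<in>F i. y < e j)"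
    by metis
  define e' where "e' = case_nat x e"
  define F' where "F' = case_nat Y F"
  have "e' j \<in> X \<and> F' j \<subseteq> X \<and> (\<forall>y\<in>F' j. e' j < y) \<and> pow_large s (e' j) (F' j)" if "j < Suc m" for j
    using that eF(1)[of "j - 1"] * by (cases j) (auto simp: e'_def F'_def)
  moreover have "e' i < e' j \<and> (\<forall>y\<in>F' i. y < e' j)" if "i < j" "j < Suc m" for i j
  proof -
    from that obtain j' where [simp]: "j = Suc j'" and "j' < m" by (cases j) auto
    with that show ?thesis using eF(1)[of j'] eF(2)[of "i - 1" j'] *
      by (cases i) (auto simp: e'_def F'_def)
  qed
  ultimately show ?case by blast
qed

text \<open>
  Every block gives up its last point, which then opens the next copy of \<open>\<omega>\<^bsup>s+1\<^esup>\<close>; the strict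
  inequalities with \<open>p\<close> pay for this point.
\<close>

lemma pow_large_combine:
  assumes "\<And>i. i < m \<Longrightarrow> pow_large s (p i) (H i)" "\<And>i. i < m \<Longrightarrow> finite (H i)"
    and "\<And>i. i < m \<Longrightarrow> \<forall>v\<in>H i. y < v" "0 < m \<Longrightarrow> y < p 0"
    and "\<And>i. Suc i < m \<Longrightarrow> \<forall>u\<in>H i. u < p (Suc i)"
    and "\<And>i j. i < j \<Longrightarrow> j < m \<Longrightarrow> \<forall>u\<in>H i. \<forall>v\<in>H j. u < v"
  shows "pow_large (Suc s) m (insert y (\<Union>i<m. H i))"
  using assms
proof (induction m arbitrary: y p H)
  case 0
  then show ?case by simp
next
  case (Suc m)
  have "pow_large s (Suc y) (H 0)"
    using Suc.prems(1)[of 0] Suc.prems(4) Suc.prems(2)[of 0] by (auto intro: pow_large_mono)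
  then obtain u where u: "u \<in> H 0" "pow_large s y (H 0 \<inter> {..<u})"
    using pow_large_less by blast
  let ?Z = "insert u (\<Union>i<m. H (Suc i))"
  have *: "pow_large (Suc s) m ?Z"
  proof (rule Suc.IH[of "\<lambda>i. p (Suc i)"])
    show "pow_large s (p (Suc i)) (H (Suc i))" "finite (H (Suc i))" if "i < m" for i
      using Suc.prems(1)[of "Suc i"] Suc.prems(2)[of "Suc i"] that by auto
    show "\<forall>v\<in>H (Suc i). v < p (Suc (Suc i))" if "Suc i < m" for i
      using Suc.prems(5)[of "Suc i"] that by auto
    show "\<forall>v\<in>H (Suc i). \<forall>w\<in>H (Suc j). v < w" if "i < j" "j < m" for i j
      using Suc.prems(6)[of "Suc i" "Suc j"] that by auto
    show "\<forall>v\<in>H (Suc i). u < v" if "i < m" for i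
      using Suc.prems(6)[of 0 "Suc i"] u that by auto
    show "u < p (Suc 0)" if "0 < m"
      using Suc.prems(5)[of 0] u that by auto
  qed
  show ?case
    unfolding pow_large.simps(3)
  proof (intro bexI exI conjI)
    show "H 0 \<inter> {..<u} \<subseteq> insert y (\<Union>i<Suc m. H i)" "?Z \<subseteq> insert y (\<Union>i<Suc m. H i)"
      using u(1) by auto
    show "\<forall>v\<in>H 0 \<inter> {..<u}. y < v" using Suc.prems(3)[of 0] by auto
    show "\<forall>z\<in>?Z. y < z"
      using Suc.prems(3)[of 0] Suc.prems(3)[of "Suc i" for i] u(1) by auto
    show "\<forall>v\<in>H 0 \<inter> {..<u}. \<forall>z\<in>?Z. v < z"
      using Suc.prems(6)[of 0 "Suc i" for i] by auto
  qed (use u(2) * in simp_all)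
qed

section \<open>Pigeonhole principles for cardinality and for largeness\<close>

lemma ex_strict_mono_enum:
  fixes J :: "nat set"
  assumes "finite J" "n \<le> card J"
  shows "\<exists>h. (\<forall>i<n. h i \<in> J) \<and> (\<forall>i j. i < j \<longrightarrow> j < n \<longrightarrow> h i < h j)"
proof (intro exI[of _ "\<lambda>i. sorted_list_of_set J ! i"] conjI allI impI)
  fix i assume "i < n"
  then show "sorted_list_of_set J ! i \<in> J"
    using assms nth_mem[of i "sorted_list_of_set J"] by auto
next
  fix i j assume "i < j" "j < n"
  then show "sorted_list_of_set J ! i < sorted_list_of_set J ! j"
    using assms strict_sorted_list_of_set[of J]
    by (auto simp: sorted_wrt_iff_nth_less)
qed

text \<open>If every class had fewer than \<open>m\<close> elements, the at most \<open>q\<close>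
  classes would add up to fewer than \<open>q * m\<close>; since \<open>A\<close> is nonempty, the
  sum estimate is strict.\<close>

lemma pigeonhole_class:
  assumes "finite A" "A \<noteq> {}" "card (c ` A) \<le> q" "q * m \<le> card A"
  shows "\<exists>v\<in>c ` A. m \<le> card {x \<in> A. c x = v}"
proof (rule ccontr)
  assume "\<not> ?thesis"
  then have "card {x \<in> A. c x = v} < m" if "v \<in> c ` A" for v
    using that by force
  then have "(\<Sum>v\<in>c ` A. card {x \<in> A. c x = v}) < (\<Sum>v\<in>c ` A. m)"
    using assms by (intro sum_strict_mono) auto
  also have "\<dots> \<le> q * m" using assms by simp
  finally have "(\<Sum>v\<in>c ` A. card {x \<in> A. c x = v}) < card A" using assms by simp
  moreover have "card A = (\<Sum>v\<in>c ` A. card {x \<in> A. c x = v})"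
    using sum.group[OF assms(1), of "c ` A" c "\<lambda>_. 1::nat"] assms(1)
    unfolding card_eq_sum by simp
  ultimately show False by simp
qed

text \<open>Induction on \<open>s\<close>. Inside a block the induction hypothesis yields a
  monochromatic part, still with more copies than any earlier point because of the cubic growth.
  Among the \<open>q * Suc m\<close> block colours one occurs \<open>Suc m\<close> times, and the
  parts of that colour are combined.\<close>

lemma pow_large_pigeonhole:
  fixes \<chi> :: "nat \<Rightarrow> 'c"
  assumes "finite X" "\<And>x y. x \<in> X \<Longrightarrow> y \<in> X \<Longrightarrow> x < y \<Longrightarrow> x ^ 3 < y"
    and "\<And>x. x \<in> X \<Longrightarrow> 2 \<le> x \<and> q \<le> x" "0 < q" "card (\<chi> ` X) \<le> q"
    and "pow_large s (q * Suc m) X"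
  shows "\<exists>c\<in>\<chi> ` X. pow_large s m {x \<in> X. \<chi> x = c}"
  using assms(1,2,3,5,6)
proof (induction s arbitrary: X m)
  case 0
  have "X \<noteq> {}" using pow_large_nonempty[OF 0(5)] \<open>0 < q\<close> by simp
  with pigeonhole_class[of X \<chi> q "Suc m"] 0 show ?case
    by (auto dest: Suc_leD)
next
  case (Suc s)
  let ?n = "q * Suc m"
  from pow_large_blocks[OF Suc.prems(5)] obtain e F where
    eF: "\<And>j. j < ?n \<Longrightarrow> e j \<in> X \<and> F j \<subseteq> X \<and> (\<forall>y\<in>F j. e j < y) \<and> pow_large s (e j) (F j)"
      "\<And>i j. i < j \<Longrightarrow> j < ?n \<Longrightarrow> e i < e j \<and> (\<forall>y\<in>F i. y < e j)"
    by metis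
  \<comment> \<open>The number \<open>p\<close> of copies must exceed every point of the earlier
    blocks, as \<open>pow_large_combine\<close> demands. Block 0 promises just one point: in an
    increasing choice of blocks it can only come first, where a single point suffices.\<close>
  define good where "good j c p F' \<longleftrightarrow> F' \<noteq> {} \<and> F' \<subseteq> insert (e j) (F j) \<and> (\<forall>x\<in>F'. \<chi> x = c) \<and>
      (0 < j \<longrightarrow> pow_large s p F' \<and> (\<forall>i<j. \<forall>u\<in>insert (e i) (F i). u < p))" for j c p F'
  have "\<exists>c p F'. good j c p F'" if j: "j < ?n" for j
  proof (cases "j = 0")
    case True
    then show ?thesis unfolding good_def
      by (intro exI[of _ "\<chi> (e 0)"] exI[of _ 0] exI[of _ "{e 0}"]) auto
  next
    case False
    let ?P = "\<Union>i<j. insert (e i) (F i)"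
    have sub: "?P \<subseteq> X"
    proof (rule UN_least)
      fix i assume "i \<in> {..<j}"
      then show "insert (e i) (F i) \<subseteq> X" using eF(1)[of i] j by simp
    qed
    have P: "finite ?P" "?P \<noteq> {}" "?P \<subseteq> X" "\<forall>u\<in>?P. u < e j"
      using finite_subset[OF sub Suc.prems(1)] sub False eF(2)[OF _ j] by auto
    define t where "t = Max ?P"
    have t: "t \<in> X" "t < e j" using Max_in[OF P(1,2)] P(3,4) by (auto simp: t_def)
    \<comment> \<open>The target inside the block is \<open>Suc t\<close> copies, one more than the
      largest earlier point, and the induction hypothesis asks for \<open>q * Suc (Suc t)\<close> of
      them. With \<open>q \<le> t\<close> and \<open>2 \<le> t\<close> this is at most
      \<open>t ^ 3\<close>, which lies below \<open>e j\<close>.\<close>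
    have "q * Suc (Suc t) \<le> t * Suc (Suc t)" "2 \<le> t"
      using Suc.prems(3)[OF t(1)] by (blast intro: mult_le_mono1)+
    moreover have "t * Suc (Suc t) \<le> t ^ 3"
    proof -
      have "Suc (Suc t) \<le> 2 * t" "2 * t \<le> t * t" using \<open>2 \<le> t\<close> by auto
      then have "Suc (Suc t) \<le> t * t" by linarith
      then have "t * Suc (Suc t) \<le> t * (t * t)" by (rule mult_le_mono2)
      then show ?thesis by (simp add: power3_eq_cube algebra_simps)
    qed
    moreover have "t ^ 3 < e j" using Suc.prems(2)[OF t(1) _ t(2)] eF(1)[OF j] by simp
    ultimately have le: "q * Suc (Suc t) \<le> e j" by linarith
    have sub: "F j \<subseteq> X" using eF(1)[OF j] by blast
    have fin: "finite (F j)" using sub Suc.prems(1) by (rule finite_subset)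
    have "\<exists>c\<in>\<chi> ` F j. pow_large s (Suc t) {x \<in> F j. \<chi> x = c}"
    proof (rule Suc.IH)
      show "card (\<chi> ` F j) \<le> q"
        using card_mono[OF _ image_mono[OF sub], of \<chi>] Suc.prems(1,4) by simp
      show "pow_large s (q * Suc (Suc t)) (F j)"
        using eF(1)[OF j] by (intro pow_large_mono[OF _ le _ fin]) auto
      show "finite (F j)" by (rule fin)
      show "x ^ 3 < y" if "x \<in> F j" "y \<in> F j" "x < y" for x y
        using that Suc.prems(2)[of x y] sub by blast
      show "2 \<le> x \<and> q \<le> x" if "x \<in> F j" for x
        using that Suc.prems(3)[of x] sub by blast
    qed
    then obtain c where c: "pow_large s (Suc t) {x \<in> F j. \<chi> x = c}" by blast
    moreover have "\<forall>i<j. \<forall>u\<in>insert (e i) (F i). u < Suc t"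
    proof (intro allI impI ballI)
      fix i u assume "i < j" "u \<in> insert (e i) (F i)"
      then have "u \<in> ?P" by blast
      then show "u < Suc t" using Max_ge[OF P(1)] by (simp add: t_def less_Suc_eq_le)
    qed
    ultimately show ?thesis using pow_large_nonempty[OF c] unfolding good_def
      by (intro exI[of _ c] exI[of _ "Suc t"] exI[of _ "{x \<in> F j. \<chi> x = c}"]) auto
  qed
  then obtain c p F' where "\<And>j. j < ?n \<Longrightarrow> good j (c j) (p j) (F' j)" by metis
  then have F': "\<And>j. j < ?n \<Longrightarrow> F' j \<noteq> {}"
      "\<And>j. j < ?n \<Longrightarrow> F' j \<subseteq> insert (e j) (F j)" "\<And>j x. j < ?n \<Longrightarrow> x \<in> F' j \<Longrightarrow> \<chi> x = c j"
      "\<And>j. j < ?n \<Longrightarrow> 0 < j \<Longrightarrow> pow_large s (p j) (F' j)"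
      "\<And>i j u. i < j \<Longrightarrow> j < ?n \<Longrightarrow> u \<in> insert (e i) (F i) \<Longrightarrow> u < p j"
    unfolding good_def by auto
  have F'X: "F' j \<subseteq> X" if "j < ?n" for j using F'(2)[OF that] eF(1)[OF that] by blast
  have "c ` {..<?n} \<subseteq> \<chi> ` X"
  proof
    fix w assume "w \<in> c ` {..<?n}"
    then obtain j where "j < ?n" "w = c j" by auto
    moreover from this obtain x where "x \<in> F' j" using F'(1)[of j] by blast
    ultimately show "w \<in> \<chi> ` X" using F'(3)[of j x] F'X[of j] by (intro image_eqI[of _ _ x]) auto
  qed
  then have "card (c ` {..<?n}) \<le> q"
    using card_mono[of "\<chi> ` X" "c ` {..<?n}"] Suc.prems(1,4) by simp
  with pigeonhole_class[of "{..<?n}" c q "Suc m"] \<open>0 < q\<close>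
  obtain v where v: "v \<in> c ` {..<?n}" "Suc m \<le> card {j \<in> {..<?n}. c j = v}" by auto
  from ex_strict_mono_enum[OF _ v(2)] obtain h where
    h: "\<And>i. i < Suc m \<Longrightarrow> h i < ?n \<and> c (h i) = v" "\<And>i j. i < j \<Longrightarrow> j < Suc m \<Longrightarrow> h i < h j"
    by auto
  \<comment> \<open>The first of the \<open>Suc m\<close> chosen blocks contributes only the opening
    point \<open>y\<close>; the other \<open>m\<close> supply the copies.\<close>
  obtain y where y: "y \<in> F' (h 0)" using F'(1) h(1)[of 0] by auto
  have lt: "u < w" if "i < j" "j < Suc m" "u \<in> F' (h i)" "w \<in> F' (h j)" for i j u w
  proof -
    have "h i < h j" "h i < ?n" "h j < ?n" using h that by auto
    then have "u < e (h j)" "e (h j) \<le> w"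
      using that F'(2)[of "h i"] F'(2)[of "h j"] eF(1)[of "h j"] eF(2)[of "h i" "h j"] by fastforce+
    then show ?thesis by simp
  qed
  have ltp: "u < p (h j)" if "i < j" "j < Suc m" "u \<in> F' (h i)" for i j u
    using that F'(2)[of "h i"] F'(5)[of "h i" "h j" u] h(1)[of i] h(1)[of j] h(2)[of i j] by auto
  have "pow_large (Suc s) m (insert y (\<Union>i<m. F' (h (Suc i))))"
  proof (rule pow_large_combine[where p = "\<lambda>i. p (h (Suc i))"])
    fix i assume i: "i < m"
    show "pow_large s (p (h (Suc i))) (F' (h (Suc i)))"
      using F'(4) h(1)[of "Suc i"] h(2)[of 0 "Suc i"] i by auto
    show "finite (F' (h (Suc i)))"
      using F'X[of "h (Suc i)"] h(1)[of "Suc i"] i Suc.prems(1) by (auto intro: finite_subset)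
    show "\<forall>v\<in>F' (h (Suc i)). y < v" using lt[of 0 "Suc i"] y i by auto
  next
    assume "0 < m"
    then show "y < p (h (Suc 0))" using ltp[of 0 "Suc 0"] y by auto
  next
    fix i assume "Suc i < m"
    then show "\<forall>u\<in>F' (h (Suc i)). u < p (h (Suc (Suc i)))"
      using ltp[of "Suc i" "Suc (Suc i)"] by auto
  next
    fix i j assume "i < j" "j < m"
    then show "\<forall>u\<in>F' (h (Suc i)). \<forall>v\<in>F' (h (Suc j)). u < v" using lt[of "Suc i" "Suc j"] by auto
  qed
  moreover have "insert y (\<Union>i<m. F' (h (Suc i))) \<subseteq> {x \<in> X. \<chi> x = v}"
  proof -
    have "F' (h i) \<subseteq> {x \<in> X. \<chi> x = v}" if "i < Suc m" for i
      using F'X[of "h i"] F'(3)[of "h i"] h(1)[OF that] by auto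
    from this[of 0] this[of "Suc i" for i] show ?thesis using y by auto
  qed
  ultimately have "pow_large (Suc s) m {x \<in> X. \<chi> x = v}"
    by (rule pow_large_superset) (use Suc.prems(1) in simp)
  with v(1) \<open>c ` {..<?n} \<subseteq> \<chi> ` X\<close> show ?case by blast
qed

section \<open>Ramsey numbers\<close>

lemma homogeneous_subset: "homogeneous f H \<Longrightarrow> H' \<subseteq> H \<Longrightarrow> homogeneous f H'"
  unfolding homogeneous_def using nsets_mono by blast

lemma homogeneousI:
  fixes H :: "'a :: linorder set"
  assumes "\<And>u v. u \<in> H \<Longrightarrow> v \<in> H \<Longrightarrow> u < v \<Longrightarrow> f {u, v} = c"
  shows "homogeneous f H"
  unfolding homogeneous_def
proof (intro exI ballI)
  fix e assume "e \<in> [H]\<^bsup>2\<^esup>"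
  then obtain u v where "e = {u, v}" "u \<in> H" "v \<in> H" "u \<noteq> v" by (auto simp: nsets_2_eq)
  then show "f e = c" using assms[of u v] assms[of v u] by (auto simp: insert_commute neq_iff)
qed

lemma ramsey_number_homogeneous:
  assumes "f \<in> [{..<ramsey_number k d}]\<^bsup>2\<^esup> \<rightarrow> {..<k}"
  shows "\<exists>H\<subseteq>{..<ramsey_number k d}. card H = d \<and> homogeneous f H"
  using LeastI_ex[OF ramsey_number_exists[of k d]] assms unfolding ramsey_number_def by blast

lemma ramsey_number_le:
  assumes "\<And>f. f \<in> [{..<R}]\<^bsup>2\<^esup> \<rightarrow> {..<k} \<Longrightarrow> \<exists>H\<subseteq>{..<R}. card H = d \<and> homogeneous f H"
  shows "ramsey_number k d \<le> R"
  unfolding ramsey_number_def by (rule Least_le) (use assms in blast)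

lemma less_ramsey_numberI:
  assumes "f \<in> [{..<N}]\<^bsup>2\<^esup> \<rightarrow> {..<k}" "\<And>H. H \<subseteq> {..<N} \<Longrightarrow> homogeneous f H \<Longrightarrow> card H \<noteq> d"
  shows "N < ramsey_number k d"
proof (rule ccontr)
  assume "\<not> N < ramsey_number k d"
  then have sub: "{..<ramsey_number k d} \<subseteq> {..<N}" by auto
  then have "f \<in> [{..<ramsey_number k d}]\<^bsup>2\<^esup> \<rightarrow> {..<k}"
    using assms(1) nsets_mono by blast
  from ramsey_number_homogeneous[OF this] obtain H
    where "H \<subseteq> {..<ramsey_number k d}" "card H = d" "homogeneous f H" by blast
  with assms(2)[of H] subset_trans[OF _ sub] show False by simp
qed

text \<open>Minimality excludes homogeneous sets of size exactly \<open>d\<close>; larger ones are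
  excluded as well, since they would contain one of size \<open>d\<close>.\<close>

lemma less_ramsey_numberE:
  assumes "N < ramsey_number k d"
  obtains f where "f \<in> [{..<N}]\<^bsup>2\<^esup> \<rightarrow> {..<k}" "\<And>H. H \<subseteq> {..<N} \<Longrightarrow> homogeneous f H \<Longrightarrow> card H < d"
proof -
  from not_less_Least[OF assms[unfolded ramsey_number_def]] obtain f where
    f: "f \<in> [{..<N}]\<^bsup>2\<^esup> \<rightarrow> {..<k}" "\<And>H. H \<subseteq> {..<N} \<Longrightarrow> homogeneous f H \<Longrightarrow> card H \<noteq> d"
    by blast
  have "card H < d" if H: "H \<subseteq> {..<N}" "homogeneous f H" for H
  proof (rule ccontr)
    assume "\<not> card H < d"
    then obtain H' where "H' \<subseteq> H" "card H' = d"
      using obtain_subset_with_card_n[of d H] by auto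
    then show False using f(2)[of H'] H homogeneous_subset by blast
  qed
  with f(1) show ?thesis by (rule that)
qed

lemma ramsey_number_mono:
  assumes "k \<le> k'" "d \<le> d'"
  shows "ramsey_number k d \<le> ramsey_number k' d'"
proof (rule ramsey_number_le)
  let ?R = "ramsey_number k' d'"
  fix f assume "f \<in> [{..<?R}]\<^bsup>2\<^esup> \<rightarrow> {..<k}"
  then have "f \<in> [{..<?R}]\<^bsup>2\<^esup> \<rightarrow> {..<k'}" using assms(1) by (auto simp: Pi_iff)
  from ramsey_number_homogeneous[OF this] obtain H
    where H: "H \<subseteq> {..<?R}" "card H = d'" "homogeneous f H" by blast
  then obtain H' where "H' \<subseteq> H" "card H' = d"
    using obtain_subset_with_card_n[of d H] assms(2) by auto
  then show "\<exists>H\<subseteq>{..<?R}. card H = d \<and> homogeneous f H"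
    using H homogeneous_subset by blast
qed

section \<open>Lower bounds for Ramsey numbers\<close>

lemma ramsey_number_ge:
  assumes "0 < k"
  shows "d \<le> ramsey_number k d"
proof -
  have "(\<lambda>_. 0) \<in> [{..<ramsey_number k d}]\<^bsup>2\<^esup> \<rightarrow> {..<k}" using assms by auto
  from ramsey_number_homogeneous[OF this] obtain H
    where "H \<subseteq> {..<ramsey_number k d}" "card H = d" by blast
  then show ?thesis using card_mono[of "{..<ramsey_number k d}" H] by auto
qed

text \<open>Extremal colourings of \<open>M\<close> and \<open>N\<close> points are placed side by
  side, pairs across getting colour 0. A homogeneous set has at most \<open>a\<close> points in the
  left part and at most \<open>b\<close> in the right one, so \<open>M + N\<close> points do not
  suffice for \<open>Suc (a + b)\<close>.\<close>

lemma ramsey_number_add: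
  assumes "0 < k"
  shows "ramsey_number k (Suc a) + ramsey_number k (Suc b) \<le> Suc (ramsey_number k (Suc (a + b)))"
proof -
  obtain M N where MN: "ramsey_number k (Suc a) = Suc M" "ramsey_number k (Suc b) = Suc N"
    using ramsey_number_ge[OF assms, of "Suc a"] ramsey_number_ge[OF assms, of "Suc b"]
    by (metis Suc_le_D)
  obtain f where f: "f \<in> [{..<M}]\<^bsup>2\<^esup> \<rightarrow> {..<k}"
      "\<And>H. H \<subseteq> {..<M} \<Longrightarrow> homogeneous f H \<Longrightarrow> card H < Suc a"
    using less_ramsey_numberE[of M k "Suc a"] MN(1) by auto
  obtain g where g: "g \<in> [{..<N}]\<^bsup>2\<^esup> \<rightarrow> {..<k}"
      "\<And>H. H \<subseteq> {..<N} \<Longrightarrow> homogeneous g H \<Longrightarrow> card H < Suc b"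
    using less_ramsey_numberE[of N k "Suc b"] MN(2) by auto
  define h where "h e = (if e \<subseteq> {..<M} then f e
    else if e \<subseteq> {M..} then g ((\<lambda>x. x - M) ` e) else 0)" for e
  have "M + N < ramsey_number k (Suc (a + b))"
  proof (rule less_ramsey_numberI)
    show "h \<in> [{..<M + N}]\<^bsup>2\<^esup> \<rightarrow> {..<k}"
    proof
      fix e assume "e \<in> [{..<M + N}]\<^bsup>2\<^esup>"
      then obtain x y where e: "e = {x, y}" "x < M + N" "y < M + N" "x \<noteq> y"
        by (auto simp: nsets_2_eq)
      consider "x < M" "y < M" | "M \<le> x" "M \<le> y" | "x < M" "M \<le> y" | "y < M" "M \<le> x"
        by linarith
      then show "h e \<in> {..<k}"
      proof cases
        case 1
        then have "e \<in> [{..<M}]\<^bsup>2\<^esup>" using e by simp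
        then show ?thesis using 1 f(1) e by (auto simp: h_def)
      next
        case 2
        then have "{x - M, y - M} \<in> [{..<N}]\<^bsup>2\<^esup>" using e by auto
        then have "g {x - M, y - M} \<in> {..<k}" using g(1) by blast
        then show ?thesis using 2 e by (auto simp: h_def)
      qed (use e assms in \<open>auto simp: h_def\<close>)
    qed
  next
    fix H assume H: "H \<subseteq> {..<M + N}" "homogeneous h H"
    then obtain c where c: "\<And>e. e \<in> [H]\<^bsup>2\<^esup> \<Longrightarrow> h e = c" unfolding homogeneous_def by blast
    have fin: "finite H" using H(1) finite_subset by blast
    have "homogeneous f (H \<inter> {..<M})"
    proof (rule homogeneousI)
      fix u v assume "u \<in> H \<inter> {..<M}" "v \<in> H \<inter> {..<M}" "u < v"
      then show "f {u, v} = c" using c[of "{u, v}"] by (auto simp: h_def)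
    qed
    then have "card (H \<inter> {..<M}) \<le> a" using f(2)[of "H \<inter> {..<M}"] by auto
    moreover have "card (H \<inter> {M..}) \<le> b"
    proof -
      let ?H = "(\<lambda>x. x - M) ` (H \<inter> {M..})"
      have "homogeneous g ?H"
      proof (rule homogeneousI)
        fix u v assume "u \<in> ?H" "v \<in> ?H" "u < v"
        then have *: "{u + M, v + M} \<in> [H]\<^bsup>2\<^esup>" by auto
        show "g {u, v} = c" using c[OF *] by (auto simp: h_def)
      qed
      then have "card ?H < Suc b" using g(2)[of ?H] H(1) by fastforce
      moreover have "card ?H = card (H \<inter> {M..})"
        by (intro card_image inj_onI) auto
      ultimately show ?thesis by simp
    qed
    moreover have "card H = card (H \<inter> {..<M}) + card (H \<inter> {M..})"
      using fin by (subst card_Un_disjoint[symmetric]) (auto intro!: arg_cong[of _ _ card])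
    ultimately show "card H \<noteq> Suc (a + b)" by simp
  qed
  then show ?thesis using MN by simp
qed

text \<open>Colour a pair from \<open>k + 1\<close> points by its smaller element, which is below
  \<open>k\<close>. In a triple the pair of the two smaller points and the pair of the two larger
  points have different minima.\<close>

lemma ramsey_number_3: "k + 2 \<le> ramsey_number k 3"
proof -
  have "Suc k < ramsey_number k 3"
  proof (rule less_ramsey_numberI)
    show "Min \<in> [{..<Suc k}]\<^bsup>2\<^esup> \<rightarrow> {..<k}" 
      by (auto simp: nsets_2_eq min_def split: if_splits)
  next
    fix H assume H: "H \<subseteq> {..<Suc k}" "homogeneous Min H"
    show "card H \<noteq> 3"
    proof
      assume "card H = 3"
      then obtain h :: "nat \<Rightarrow> nat"
        where h: "\<And>i. i < 3 \<Longrightarrow> h i \<in> H" "\<And>i j. i < j \<Longrightarrow> j < 3 \<Longrightarrow> h i < h j"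
        using ex_strict_mono_enum[of H 3] finite_subset[OF H(1)] by auto
      have lt: "h 0 < h 1" "h 1 < h 2" using h(2) by auto
      have "{h 0, h 1} \<in> [H]\<^bsup>2\<^esup>" "{h 1, h 2} \<in> [H]\<^bsup>2\<^esup>" using h(1) lt by auto
      then have "Min {h 0, h 1} = Min {h 1, h 2}" using H(2) unfolding homogeneous_def by metis
      then show False using lt by (simp add: min_def)
    qed
  qed
  then show ?thesis by simp
qed

text \<open>Additivity is used twice, through the sizes \<open>2 * t\<close> and
  \<open>2 * t + 2\<close>. The bound \<open>t + 2 \<le> ramsey_number t 3\<close> pays for the
  summand \<open>t\<close> and for the two units lost on the way.\<close>

lemma ramsey_number_double:
  assumes "0 < t"
  shows "t + ramsey_number t t + ramsey_number t (t + 1) \<le> ramsey_number t (2 * t + 2)"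
proof -
  obtain t' where t': "t = Suc t'" using assms by (cases t) auto
  have "ramsey_number t t + ramsey_number t (t + 1) \<le> Suc (ramsey_number t (2 * t))"
    using ramsey_number_add[OF assms, of t' t] t' by (simp add: mult_2)
  moreover have "ramsey_number t (2 * t) + ramsey_number t 3 \<le> Suc (ramsey_number t (2 * t + 2))"
    using ramsey_number_add[OF assms, of "2 * t - 1" 2] t' by (simp add: numeral_3_eq_3)
  ultimately show ?thesis using ramsey_number_3[of t] by linarith
qed

text \<open>Translates sparsity into the growth that the thinning of blocks consumes:
  \<open>k ^ u\<close> for the colours seen from at most \<open>u\<close> earlier points, the next
  power of \<open>k\<close> for the colours towards later blocks, and the last factor for the copies
  that must survive. Each factor is bounded by a power of \<open>u\<close>, and
  \<open>ramsey_number_double\<close> bounds the sum of the exponents.\<close>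

lemma sparse_ramsey_bound:
  assumes "sparse (\<lambda>x. x ^ ramsey_number x (2 * x + 2)) X" "u \<in> X" "v \<in> X" "u < v"
    and "0 < k" "k \<le> u" "2 \<le> u" "p < u"
  shows "k ^ u * (k ^ ramsey_number k (p + 1) * (ramsey_number k (u + 1) + 3) + 1) \<le> v" "u ^ 3 < v"
proof -
  let ?N = "ramsey_number k (p + 1)" and ?R = "ramsey_number k (u + 1)"
  have less: "u ^ ramsey_number u (2 * u + 2) < v" using assms(1-4) unfolding sparse_def by blast
  have "3 \<le> ramsey_number u (2 * u + 2)"
    using ramsey_number_ge[of u "2 * u + 2"] assms(7) by linarith
  then have "u ^ 3 \<le> u ^ ramsey_number u (2 * u + 2)" using assms(7) by (intro power_increasing) auto
  with less show "u ^ 3 < v" by simp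
  have "3 \<le> ?R" using ramsey_number_ge[OF assms(5), of "u + 1"] assms(7) by linarith
  \<comment> \<open>True from 3 on, where it reads \<open>7 \<le> 8\<close>. It absorbs the last
    factor into a power of \<open>u\<close>, after the final \<open>+ 1\<close> has been enlarged to
    \<open>k ^ ?N\<close> to get a common factor.\<close>
  then have "?R + 4 \<le> 2 ^ ?R"
    by (induction rule: dec_induct) auto
  also have "\<dots> \<le> u ^ ?R" using assms(7) by (intro power_mono) auto
  finally have R: "?R + 4 \<le> u ^ ?R" .
  have "k ^ u * (k ^ ?N * (?R + 3) + 1) \<le> k ^ u * (k ^ ?N * (?R + 3) + k ^ ?N)"
    using assms(5) by (intro mult_le_mono2 add_left_mono) auto
  also have "\<dots> = k ^ u * k ^ ?N * (?R + 4)" by (simp add: algebra_simps)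
  also have "\<dots> \<le> u ^ u * u ^ ?N * u ^ ?R"
    using assms(6) R by (intro mult_le_mono power_mono) auto
  also have "\<dots> = u ^ (u + ?N + ?R)" by (simp add: power_add)
  also have "\<dots> \<le> u ^ ramsey_number u (2 * u + 2)"
    using ramsey_number_double[of u] ramsey_number_mono[of k u "p + 1" u]
      ramsey_number_mono[of k u "u + 1" "u + 1"] assms(6-8)
    by (intro power_increasing) auto
  finally show "k ^ u * (k ^ ?N * (?R + 3) + 1) \<le> v" using less by simp
qed

section \<open>Homogeneous sets\<close>

text \<open>All colourings \<open>\<phi> i\<close> are handled at once by colouring \<open>x\<close>
  with the vector of its values. \<open>restrict\<close> makes these vectors elements of a finite
  product with at most \<open>k ^ d\<close> members, so one pigeonhole step suffices.\<close>

lemma pow_large_thin: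
  fixes \<phi> :: "'i \<Rightarrow> nat \<Rightarrow> nat"
  assumes "finite X" "\<And>x y. x \<in> X \<Longrightarrow> y \<in> X \<Longrightarrow> x < y \<Longrightarrow> x ^ 3 < y"
    and "\<And>x. x \<in> X \<Longrightarrow> 2 \<le> x \<and> k ^ d \<le> x" "0 < k" "finite I" "card I \<le> d"
    and "\<And>i x. i \<in> I \<Longrightarrow> x \<in> X \<Longrightarrow> \<phi> i x < k" "pow_large s (k ^ d * Suc m) X"
  shows "\<exists>D\<subseteq>X. pow_large s m D \<and> (\<forall>i\<in>I. \<forall>x\<in>D. \<forall>y\<in>D. \<phi> i x = \<phi> i y)"
proof -
  define \<chi> where "\<chi> x = restrict (\<lambda>i. \<phi> i x) I" for x
  have "\<chi> ` X \<subseteq> I \<rightarrow>\<^sub>E {..<k}" using assms(7) by (auto simp: \<chi>_def)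
  then have "card (\<chi> ` X) \<le> card (I \<rightarrow>\<^sub>E {..<k})"
    using assms(5) by (intro card_mono finite_PiE) auto
  also have "\<dots> = k ^ card I" using assms(5) by (simp add: card_PiE)
  also have "\<dots> \<le> k ^ d" using assms(4,6) by (intro power_increasing) auto
  finally have "card (\<chi> ` X) \<le> k ^ d" .
  moreover have "0 < k ^ d" using assms(4) by simp
  ultimately obtain c where "pow_large s m {x \<in> X. \<chi> x = c}"
    using pow_large_pigeonhole[of X "k ^ d" \<chi> s m, OF assms(1-3) _ _ assms(8)] by blast
  moreover have "\<forall>i\<in>I. \<forall>x\<in>{x \<in> X. \<chi> x = c}. \<forall>y\<in>{x \<in> X. \<chi> x = c}. \<phi> i x = \<phi> i y"
  proof (intro ballI)
    fix i x y assume "i \<in> I" "x \<in> {x \<in> X. \<chi> x = c}" "y \<in> {x \<in> X. \<chi> x = c}"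
    then have "\<chi> x i = \<chi> y i" by simp
    with \<open>i \<in> I\<close> show "\<phi> i x = \<phi> i y" by (simp add: \<chi>_def)
  qed
  moreover have "{x \<in> X. \<chi> x = c} \<subseteq> X" by blast
  ultimately show ?thesis by blast
qed

text \<open>
  A block is first thinned so that each earlier point of \<open>X\<close> sees a single colour in it, and then
  so that all its points see the same colour in each later block.
\<close>

lemma ex_cross_homogeneous_blocks:
  fixes f :: "nat set \<Rightarrow> nat" and r :: "nat \<Rightarrow> nat"
  assumes "finite X" "f \<in> [X]\<^bsup>2\<^esup> \<rightarrow> {..<k}" "0 < k"
    and cube: "\<And>x y. x \<in> X \<Longrightarrow> y \<in> X \<Longrightarrow> x < y \<Longrightarrow> x ^ 3 < y"
    and two: "\<And>x. x \<in> X \<Longrightarrow> 2 \<le> x"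
    and bound: "\<And>u v. u \<in> X \<Longrightarrow> v \<in> X \<Longrightarrow> u < v \<Longrightarrow> k ^ u * Suc (k ^ N * Suc (r u)) \<le> v"
    and "\<And>u. 0 < r u" "pow_large (Suc s) (Suc N) X"
  shows "\<exists>D w g. (\<forall>j<N. D j \<subseteq> X \<and> pow_large s (r (w j)) (D j)) \<and>
    (\<forall>i j. i < j \<longrightarrow> j < N \<longrightarrow>
      (\<forall>u\<in>D i. u \<le> w j \<and> (\<forall>v\<in>D j. u < v \<and> f {u, v} = g {i, j})))"
proof -
  from pow_large_blocks[OF assms(8)] obtain e F where
    eF: "\<And>j. j < Suc N \<Longrightarrow> e j \<in> X \<and> F j \<subseteq> X \<and> (\<forall>y\<in>F j. e j < y) \<and> pow_large s (e j) (F j)"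
      "\<And>i j. i < j \<Longrightarrow> j < Suc N \<Longrightarrow> e i < e j \<and> (\<forall>y\<in>F i. y < e j)"
    by metis
  \<comment> \<open>\<open>P j\<close> holds everything before block \<open>Suc j\<close>. Block 0
    is spent on making \<open>P j\<close> nonempty, so that \<open>w j\<close> is a genuine maximum,
    and the output block \<open>j\<close> is carved out of \<open>F (Suc j)\<close>.\<close>
  define P where "P j = X \<inter> {..<e (Suc j)}" for j
  define w where "w j = Max (P j)" for j
  have f: "f {x, y} < k" if "x \<in> X" "y \<in> X" "x < y" for x y
    using assms(2) that by (auto simp: Pi_iff)
  have w: "w j \<in> X" "w j < e (Suc j)" "\<forall>u\<in>P j. u \<le> w j" if "j < N" for j
  proof -
    have "finite (P j)" "e 0 \<in> P j"
      using assms(1) eF(1)[of 0] eF(2)[of 0 "Suc j"] that by (auto simp: P_def)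
    moreover from this have "w j \<in> P j" unfolding w_def by (intro Max_in) auto
    ultimately show "w j \<in> X" "w j < e (Suc j)" "\<forall>u\<in>P j. u \<le> w j"
      by (auto simp: P_def w_def)
  qed
  have F: "F (Suc j) \<subseteq> X" "finite (F (Suc j))"
      "k ^ w j * Suc (k ^ N * Suc (r (w j))) \<le> e (Suc j)"
      "\<And>y. y \<in> F (Suc j) \<Longrightarrow> e (Suc j) < y" if "j < N" for j
    using eF(1)[of "Suc j"] that assms(1) bound[OF w(1)[OF that] _ w(2)[OF that]]
    by (auto intro: finite_subset)
  \<comment> \<open>Both thinnings are instances of this: points of \<open>F (Suc j)\<close> lie
    above \<open>e (Suc j)\<close>, hence above the number of colour vectors.\<close>
  have thin: "\<exists>D'\<subseteq>D. pow_large s m D' \<and> (\<forall>i\<in>I. \<forall>x\<in>D'. \<forall>y\<in>D'. \<phi> i x = \<phi> i y)"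
    if "j < N" "D \<subseteq> F (Suc j)" "k ^ d \<le> e (Suc j)" "finite I" "card I \<le> d"
      "\<And>i x. i \<in> I \<Longrightarrow> x \<in> D \<Longrightarrow> \<phi> i x < k" "pow_large s (k ^ d * Suc m) D"
    for j D d m and I :: "nat set" and \<phi> :: "nat \<Rightarrow> nat \<Rightarrow> nat"
  proof (rule pow_large_thin)
    have sub: "D \<subseteq> X" using that(2) F(1)[OF that(1)] by blast
    then show "finite D" using assms(1) by (rule finite_subset)
    show "x ^ 3 < y" if "x \<in> D" "y \<in> D" "x < y" for x y
      using that sub cube by blast
    show "2 \<le> x \<and> k ^ d \<le> x" if "x \<in> D" for x
      using that sub two[of x] F(4)[OF \<open>j < N\<close>, of x] \<open>D \<subseteq> F (Suc j)\<close> \<open>k ^ d \<le> e (Suc j)\<close>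
      by (auto dest: subsetD)
  qed (fact that assms(3))+
  have "\<exists>D\<subseteq>F (Suc j). pow_large s (k ^ N * Suc (r (w j))) D \<and>
      (\<forall>y\<in>P j. \<forall>x\<in>D. \<forall>x'\<in>D. f {y, x} = f {y, x'})" if j: "j < N" for j
  proof (rule thin[OF j subset_refl, where d = "w j" and \<phi> = "\<lambda>y x. f {y, x}"])
    show "k ^ w j \<le> e (Suc j)"
      using F(3)[OF j] by simp
    show "finite (P j)" using assms(1) by (simp add: P_def)
    \<comment> \<open>Since 0 is not in \<open>X\<close>, there are at most \<open>w j\<close>
      earlier points, which explains the factor \<open>k ^ w j\<close>.\<close>
    have "P j \<subseteq> {1..w j}" using w(3)[OF j] two by (fastforce simp: P_def)
    then show "card (P j) \<le> w j" using card_mono[of "{1..w j}" "P j"] by simp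
    show "f {y, x} < k" if "y \<in> P j" "x \<in> F (Suc j)" for y x
      using that F(1,4)[OF j] by (intro f) (auto simp: P_def intro: order.strict_trans)
    show "pow_large s (k ^ w j * Suc (k ^ N * Suc (r (w j)))) (F (Suc j))"
      using eF(1)[of "Suc j"] j by (intro pow_large_mono[OF _ F(3)[OF j] _ F(2)[OF j]]) auto
  qed
  then obtain D1 where D1: "\<And>j. j < N \<Longrightarrow> D1 j \<subseteq> F (Suc j)"
      "\<And>j. j < N \<Longrightarrow> pow_large s (k ^ N * Suc (r (w j))) (D1 j)"
      "\<And>j y x x'. j < N \<Longrightarrow> y \<in> P j \<Longrightarrow> x \<in> D1 j \<Longrightarrow> x' \<in> D1 j \<Longrightarrow> f {y, x} = f {y, x'}"
    by metis
  \<comment> \<open>The colour that an earlier point \<open>y\<close> sees in \<open>D1 j\<close>;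
    by the first thinning any representative gives the same value.\<close>
  define a where "a j y = f {y, SOME x. x \<in> D1 j}" for j y
  have ne: "(SOME x. x \<in> D1 j) \<in> D1 j" if "j < N" for j
    using pow_large_nonempty[OF D1(2)[OF that]] assms(3) by (simp add: some_in_eq)
  have a: "f {y, x} = a j y" if "j < N" "y \<in> P j" "x \<in> D1 j" for j y x
    unfolding a_def using D1(3)[OF that ne[OF that(1)]] .
  have P: "x \<in> P j" if "i < j" "j < N" "x \<in> D1 i" for i j x
    using that D1(1)[of i] F(1)[of i] eF(2)[of "Suc i" "Suc j"] by (auto simp: P_def)
  \<comment> \<open>The second thinning is over the later block indices, of which there are at most
    \<open>N\<close>.\<close>
  have "\<exists>D\<subseteq>D1 i. pow_large s (r (w i)) D \<and>
      (\<forall>j\<in>{i<..<N}. \<forall>x\<in>D. \<forall>y\<in>D. a j x = a j y)" if i: "i < N" for i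
  proof (rule thin[OF i D1(1)[OF i], where d = N and \<phi> = a])
    have "k ^ N \<le> k ^ w i * Suc (k ^ N * Suc (r (w i)))"
    proof -
      have "1 * k ^ N \<le> k ^ w i * Suc (k ^ N * Suc (r (w i)))"
        using assms(3) by (intro mult_le_mono) auto
      then show ?thesis by simp
    qed
    then show "k ^ N \<le> e (Suc i)" using F(3)[OF i] by linarith
    show "a j x < k" if "j \<in> {i<..<N}" "x \<in> D1 i" for j x
    proof -
      have "x \<in> P j" using P that by auto
      moreover have "(SOME x. x \<in> D1 j) \<in> F (Suc j)" using D1(1)[of j] ne[of j] that by auto
      ultimately show ?thesis unfolding a_def using that F(1,4)[of j]
        by (intro f) (auto simp: P_def intro: order.strict_trans)
    qed
  qed (use D1(2)[OF i] in auto)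
  then obtain D where D0: "\<And>i. i < N \<Longrightarrow> D i \<subseteq> D1 i \<and> pow_large s (r (w i)) (D i) \<and>
      (\<forall>j\<in>{i<..<N}. \<forall>x\<in>D i. \<forall>y\<in>D i. a j x = a j y)"
    by metis
  have D: "D i \<subseteq> D1 i" "pow_large s (r (w i)) (D i)" if "i < N" for i
    using D0[OF that] by blast+
  have aD: "a j x = a j y" if "i < j" "j < N" "x \<in> D i" "y \<in> D i" for i j x y
  proof -
    have "i < N" "j \<in> {i<..<N}" using that by auto
    with D0 that(3,4) show ?thesis by blast
  qed
  \<comment> \<open>Writing the block colour as a function of the index set, through
    \<open>Min\<close> and \<open>Max\<close>, makes \<open>g\<close> a colouring of pairs to which
    Ramsey's theorem applies.\<close>
  define g where "g S = a (Max S) (SOME x. x \<in> D (Min S))" for S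
  have "u \<le> w j \<and> (\<forall>v\<in>D j. u < v \<and> f {u, v} = g {i, j})"
    if ij: "i < j" "j < N" and u: "u \<in> D i" for i j u
  proof (intro conjI ballI)
    have i: "i < N" using ij by simp
    have uP: "u \<in> P j" using P[OF ij] D(1)[OF i] u by blast
    then show "u \<le> w j" using w(3)[OF ij(2)] by blast
    fix v assume "v \<in> D j"
    then have v: "v \<in> D1 j" using D(1)[OF ij(2)] by blast
    then show "u < v" using uP D1(1)[OF ij(2)] F(4)[OF ij(2)] by (fastforce simp: P_def)
    have "(SOME x. x \<in> D i) \<in> D i" using u by (rule someI)
    then have "a j u = g {i, j}" using aD[OF ij u] ij(1) by (simp add: g_def max_def min_def)
    then show "f {u, v} = g {i, j}" using a[OF ij(2) uP v] by simp
  qed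
  moreover have "D j \<subseteq> X \<and> pow_large s (r (w j)) (D j)" if "j < N" for j
    using D(1,2)[OF that] D1(1)[OF that] F(1)[OF that] by blast
  ultimately show ?thesis by blast
qed

text \<open>The homogeneous indices are listed increasingly as \<open>h 0\<close> to
  \<open>h p\<close>. The assumption \<open>0 < p\<close> provides at least one pair, whose colour
  shows \<open>c < k\<close>.\<close>

lemma ramsey_indexed:
  fixes f :: "nat set \<Rightarrow> nat"
  assumes "\<And>i j. i < j \<Longrightarrow> j < ramsey_number k (p + 1) \<Longrightarrow> f {i, j} < k" "0 < p"
  shows "\<exists>h c. c < k \<and> (\<forall>i\<le>p. h i < ramsey_number k (p + 1)) \<and>
    (\<forall>i j. i < j \<longrightarrow> j \<le> p \<longrightarrow> h i < h j \<and> f {h i, h j} = c)"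
proof -
  let ?R = "ramsey_number k (p + 1)"
  have "f \<in> [{..<?R}]\<^bsup>2\<^esup> \<rightarrow> {..<k}"
  proof
    fix e assume "e \<in> [{..<?R}]\<^bsup>2\<^esup>"
    then obtain x y where "e = {x, y}" "x < ?R" "y < ?R" "x \<noteq> y" by (auto simp: nsets_2_eq)
    then show "f e \<in> {..<k}" using assms(1)[of x y] assms(1)[of y x]
      by (auto simp: neq_iff insert_commute)
  qed
  from ramsey_number_homogeneous[OF this] obtain H where
    H: "H \<subseteq> {..<?R}" "card H = p + 1" "homogeneous f H" by blast
  from H(3) obtain c where c: "\<And>e. e \<in> [H]\<^bsup>2\<^esup> \<Longrightarrow> f e = c" unfolding homogeneous_def by blast
  have "finite H" using H(1) by (rule finite_subset) simp
  then obtain h where h: "\<And>i. i < p + 1 \<Longrightarrow> h i \<in> H" "\<And>i j. i < j \<Longrightarrow> j < p + 1 \<Longrightarrow> h i < h j"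
    using ex_strict_mono_enum[of H "p + 1"] H(2) by auto
  have "h i < h j \<and> f {h i, h j} = c" if "i < j" "j \<le> p" for i j
    using h(1)[of i] h(1)[of j] h(2)[of i j] c[of "{h i, h j}"] that by auto
  moreover have "h i < ?R" if "i \<le> p" for i using h(1)[of i] H(1) that by auto
  moreover from calculation(1)[of 0 1] calculation(2)[of 1] have "c < k"
    using assms(1)[of "h 0" "h 1"] assms(2) by auto
  ultimately show ?thesis by blast
qed

text \<open>
  If the common colour of the blocks is \<open>c\<close>, then within each of them the target \<open>\<omega>\<^bsup>b c\<^esup> \<cdot> m c\<close> is
  replaced by \<open>\<omega>\<^bsup>b c - 1\<^esup> \<cdot> u\<close>, where \<open>u\<close> bounds the points used in the preceding block.
\<close>

lemma pow_large_ramsey: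
  fixes f :: "nat set \<Rightarrow> nat" and b m :: "nat \<Rightarrow> nat"
  assumes "finite X" "sparse (\<lambda>x. x ^ ramsey_number x (2 * x + 2)) X"
    and "\<And>x. x \<in> X \<Longrightarrow> p < x" "k \<le> p" "0 < k" "f \<in> [X]\<^bsup>2\<^esup> \<rightarrow> {..<k}"
    and "\<And>i. i < k \<Longrightarrow> m i \<le> p" "(\<Sum>i<k. b i) = s"
    and "pow_large s (Suc (ramsey_number k (p + 1))) X"
  shows "\<exists>i<k. \<exists>H\<subseteq>X. pow_large (b i) (m i) H \<and> (\<forall>u\<in>H. \<forall>v\<in>H. u < v \<longrightarrow> f {u, v} = i)"
  using assms(1-4,6-9)
proof (induction s arbitrary: X p m b)
  case 0
  let ?R = "ramsey_number k (p + 1)"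
  have p: "0 < p" using 0(4) \<open>0 < k\<close> by simp
  \<comment> \<open>All exponents are 0 here, so the targets are cardinalities at most
    \<open>p\<close> and finite Ramsey suffices.\<close>
  from 0(8) have "?R \<le> card X" by simp
  from ex_strict_mono_enum[OF 0(1) this] obtain e where
    e: "\<And>i. i < ?R \<Longrightarrow> e i \<in> X" "\<And>i j. i < j \<Longrightarrow> j < ?R \<Longrightarrow> e i < e j" by blast
  have "f (e ` {i, j}) < k" if "i < j" "j < ?R" for i j
    using 0(5) e(1)[of i] e(1)[of j] e(2)[of i j] that by (auto simp: Pi_iff)
  from ramsey_indexed[of k p "\<lambda>S. f (e ` S)", OF this p] obtain h c where
    h: "c < k" "\<And>i. i \<le> p \<Longrightarrow> h i < ?R"
      "\<And>i j. i < j \<Longrightarrow> j \<le> p \<Longrightarrow> h i < h j \<and> f (e ` {h i, h j}) = c" by blast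
  let ?H = "(\<lambda>i. e (h i)) ` {..p}"
  have lt: "e (h i) < e (h j)" if "i < j" "j \<le> p" for i j
    using h(2)[of j] h(3)[of i j] e(2)[of "h i" "h j"] that by auto
  have "inj_on (\<lambda>i. e (h i)) {..p}"
    by (rule inj_onI) (metis atMost_iff lt less_irrefl linorder_neqE_nat)
  then have "card ?H = p + 1" by (simp add: card_image)
  moreover have "f {u, v} = c" if "u \<in> ?H" "v \<in> ?H" "u < v" for u v
  proof -
    from that obtain i j where ij: "i \<le> p" "j \<le> p" "u = e (h i)" "v = e (h j)" by auto
    have "i < j" using lt[of j i] ij that(3) by (cases i j rule: linorder_cases) auto
    with h(3)[of i j] ij show ?thesis by simp
  qed
  moreover have "?H \<subseteq> X" using h(2) e(1) by auto
  moreover have "b c = 0" using 0(7) h(1) by simp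
  moreover have "m c \<le> p + 1" using 0(6)[OF h(1)] by simp
  ultimately show ?case using h(1) by (intro exI[of _ c] conjI exI[of _ ?H]) simp_all
next
  case (Suc s)
  let ?R = "\<lambda>p. ramsey_number k (p + 1)"
  note prems = Suc.prems
  have p: "0 < p" using prems(4) \<open>0 < k\<close> by simp
  have X: "p < x" "k \<le> x" "2 \<le> x" if "x \<in> X" for x
    using prems(3)[OF that] prems(4) p by auto
  have fk: "f {x, y} < k" if "x \<in> X" "y \<in> X" "x < y" for x y
    using prems(5) that by (auto simp: Pi_iff)
  \<comment> \<open>Of the two extra copies, one belongs to the size \<open>Suc (?R (w j))\<close>
    required by the induction hypothesis and the other is given up for a free point on top of the
    block.\<close>
  have "\<exists>D w g. (\<forall>j<?R p. D j \<subseteq> X \<and> pow_large s (?R (w j) + 2) (D j)) \<and>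
    (\<forall>i j. i < j \<longrightarrow> j < ?R p \<longrightarrow>
      (\<forall>u\<in>D i. u \<le> w j \<and> (\<forall>v\<in>D j. u < v \<and> f {u, v} = g {i, j})))"
  proof (rule ex_cross_homogeneous_blocks[where r = "\<lambda>u. ?R u + 2"])
    show "x ^ 3 < y" if "x \<in> X" "y \<in> X" "x < y" for x y
      using sparse_ramsey_bound(2)[OF prems(2) that \<open>0 < k\<close> X(2,3,1)[OF that(1)]] .
    show "k ^ u * Suc (k ^ ?R p * Suc (?R u + 2)) \<le> v" if "u \<in> X" "v \<in> X" "u < v" for u v
      using sparse_ramsey_bound(1)[OF prems(2) that \<open>0 < k\<close> X(2,3,1)[OF that(1)]]
      by (simp add: numeral_3_eq_3)
  qed (use prems(1,5,8) \<open>0 < k\<close> X(3) in simp_all)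
  then obtain D w g where
    D: "\<And>j. j < ?R p \<Longrightarrow> D j \<subseteq> X" "\<And>j. j < ?R p \<Longrightarrow> pow_large s (?R (w j) + 2) (D j)"
    and cross: "\<And>i j u v. i < j \<Longrightarrow> j < ?R p \<Longrightarrow> u \<in> D i \<Longrightarrow> v \<in> D j \<Longrightarrow> u < v"
      "\<And>i j u v. i < j \<Longrightarrow> j < ?R p \<Longrightarrow> u \<in> D i \<Longrightarrow> v \<in> D j \<Longrightarrow> f {u, v} = g {i, j}"
    and w: "\<And>i j u. i < j \<Longrightarrow> j < ?R p \<Longrightarrow> u \<in> D i \<Longrightarrow> u \<le> w j"
    by (elim exE conjE) blast
  have "\<exists>u\<in>D j. pow_large s (Suc (?R (w j))) (D j \<inter> {..<u})" if "j < ?R p" for j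
    using pow_large_less[of s "Suc (?R (w j))" "D j"] D(2)[OF that] by simp
  then obtain u where u: "\<And>j. j < ?R p \<Longrightarrow> u j \<in> D j"
      "\<And>j. j < ?R p \<Longrightarrow> pow_large s (Suc (?R (w j))) (D j \<inter> {..<u j})"
    by metis
  define E where "E j = D j \<inter> {..<u j}" for j
  have "g {i, j} < k" if "i < j" "j < ?R p" for i j
  proof -
    have "i < ?R p" using that by simp
    then show ?thesis
      using cross[OF that u(1) u(1)[OF that(2)]] fk[of "u i" "u j"] u(1)[of i] u(1)[of j]
        D(1)[of i] D(1)[of j] that
      by auto
  qed
  from ramsey_indexed[of k p g, OF this p] obtain h c where
    h: "c < k" "\<And>i. i \<le> p \<Longrightarrow> h i < ?R p"
      "\<And>i j. i < j \<Longrightarrow> j \<le> p \<Longrightarrow> h i < h j" "\<And>i j. i < j \<Longrightarrow> j \<le> p \<Longrightarrow> g {h i, h j} = c"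
    by blast
  have E: "E (h i) \<subseteq> D (h i)" "E (h i) \<subseteq> X" "E (h i) \<noteq> {}" "\<And>v. v \<in> E (h i) \<Longrightarrow> v < u (h i)"
      "u (h i) \<in> X" if "i \<le> p" for i
    using pow_large_nonempty[OF u(2)[OF h(2)[OF that]]] D(1)[OF h(2)[OF that]] u(1)[OF h(2)[OF that]]
    by (auto simp: E_def)
  have lt: "x < y" and fc: "f {x, y} = c"
    if "i < j" "j \<le> p" "x \<in> D (h i)" "y \<in> D (h j)" for i j x y
    using cross[OF h(3)[OF that(1,2)] h(2)[OF that(2)] that(3,4)] h(4)[OF that(1,2)] by auto
  have mc: "m c \<le> p" using prems(6)[OF h(1)] .
  show ?case
  proof (cases "b c")
    case 0
    \<comment> \<open>With \<open>b c = 0\<close> the target of \<open>c\<close> is a cardinality at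
      most \<open>p\<close>; one free point from each of the \<open>p + 1\<close> blocks already
      exceeds it.\<close>
    let ?H = "(\<lambda>i. u (h i)) ` {..p}"
    have uD: "u (h i) \<in> D (h i)" if "i \<le> p" for i using u(1) h(2) that by blast
    have lt': "u (h i) < u (h j)" if "i < j" "j \<le> p" for i j
      using lt[OF that uD uD] that by simp
    have "inj_on (\<lambda>i. u (h i)) {..p}"
      by (rule inj_onI) (metis atMost_iff lt' less_irrefl linorder_neqE_nat)
    then have "card ?H = p + 1" by (simp add: card_image)
    moreover have "f {x, y} = c" if "x \<in> ?H" "y \<in> ?H" "x < y" for x y
    proof -
      from that obtain i j where ij: "i \<le> p" "j \<le> p" "x = u (h i)" "y = u (h j)" by auto
      have "i < j" using lt'[of j i] ij that(3) by (cases i j rule: linorder_cases) auto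
      then show ?thesis using fc[OF _ ij(2) uD uD] ij by simp
    qed
    moreover have "?H \<subseteq> X" using E(5) by auto
    ultimately show ?thesis using h(1) mc 0 by (intro exI[of _ c] conjI exI[of _ ?H]) simp_all
  next
    case b: (Suc b')
    define won where "won i X H b m \<longleftrightarrow> H \<subseteq> X \<and> pow_large (b i) (m i) H \<and>
      (\<forall>u\<in>H. \<forall>v\<in>H. u < v \<longrightarrow> f {u, v} = i)" for i :: nat and X H and b m :: "nat \<Rightarrow> nat"
    \<comment> \<open>The free point \<open>u (h i)\<close> of one block becomes the bound
      \<open>p\<close> for the next. It lies below that block and above the old \<open>p\<close>, so
      it bounds the unchanged multiplicities and can itself be the new multiplicity of
      \<open>c\<close>.\<close>
    have IH: "\<exists>j<k. \<exists>H. won j (E (h (Suc i))) H (b(c := b')) (m(c := u (h i)))" if i: "i < p" for i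
      unfolding won_def
    proof (rule Suc.IH)
      have i': "i \<le> p" "Suc i \<le> p" using i by auto
      note EX = E(2)[OF i'(2)]
      show "finite (E (h (Suc i)))" using EX prems(1) by (rule finite_subset)
      show "sparse (\<lambda>x. x ^ ramsey_number x (2 * x + 2)) (E (h (Suc i)))"
        using prems(2) EX unfolding sparse_def by blast
      show "u (h i) < x" if "x \<in> E (h (Suc i))" for x
        using lt[of i "Suc i" "u (h i)" x] u(1) h(2) i' E(1)[OF i'(2)] that by auto
      show "k \<le> u (h i)" using X(2) E(5)[OF i'(1)] .
      show "f \<in> [E (h (Suc i))]\<^bsup>2\<^esup> \<rightarrow> {..<k}" using prems(5) nsets_mono[OF EX] by blast
      show "(m(c := u (h i))) j \<le> u (h i)" if "j < k" for j
        using prems(6)[OF that] X(1)[OF E(5)[OF i'(1)]] by auto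
      have "(\<Sum>j<k. b j) = b c + (\<Sum>j\<in>{..<k} - {c}. b j)"
        using h(1) by (simp add: sum.remove)
      moreover have "(\<Sum>j<k. (b(c := b')) j) = b' + (\<Sum>j\<in>{..<k} - {c}. b j)"
        using h(1) by (simp add: sum.remove[of "{..<k}" c])
      ultimately show "(\<Sum>j<k. (b(c := b')) j) = s" using prems(7) b by simp
      \<comment> \<open>The block was sized by \<open>w\<close>, which bounds all points of earlier
        blocks; monotonicity of Ramsey numbers turns this into the size needed for
        \<open>u (h i)\<close>.\<close>
      have "u (h i) \<le> w (h (Suc i))" using w[OF h(3) h(2) u(1)[OF h(2)]] i' by simp
      then have "Suc (?R (u (h i))) \<le> Suc (?R (w (h (Suc i))))"
        using ramsey_number_mono[of k k "u (h i) + 1" "w (h (Suc i)) + 1"] by simp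
      then show "pow_large s (Suc (?R (u (h i)))) (E (h (Suc i)))"
        using pow_large_mono[OF u(2)[OF h(2)[OF i'(2)]] _ _ finite_subset[OF EX prems(1)]]
        by (auto simp: E_def)
    qed
    show ?thesis
    proof (cases "\<exists>i<p. \<exists>j<k. j \<noteq> c \<and> (\<exists>H. won j (E (h (Suc i))) H (b(c := b')) (m(c := u (h i))))")
      case True
      then obtain i j H where *: "i < p" "j < k" "j \<noteq> c"
        and won: "won j (E (h (Suc i))) H (b(c := b')) (m(c := u (h i)))" by blast
      \<comment> \<open>Since \<open>j \<noteq> c\<close>, the updates at \<open>c\<close> leave the
        target of \<open>j\<close> unchanged.\<close>
      have "H \<subseteq> X \<and> pow_large (b j) (m j) H \<and> (\<forall>u\<in>H. \<forall>v\<in>H. u < v \<longrightarrow> f {u, v} = j)"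
        using won * E(2)[of "Suc i"] unfolding won_def by auto
      then show ?thesis using *(2) by blast
    next
      case False
      with IH have "\<exists>H. won c (E (h (Suc i))) H (b(c := b')) (m(c := u (h i)))" if "i < p" for i
        using that by metis
      then obtain H where "\<And>i. i < p \<Longrightarrow> won c (E (h (Suc i))) (H i) (b(c := b')) (m(c := u (h i)))"
        by metis
      then have H: "\<And>i. i < p \<Longrightarrow> H i \<subseteq> E (h (Suc i))"
          "\<And>i. i < p \<Longrightarrow> pow_large b' (u (h i)) (H i)"
          "\<And>i x y. i < p \<Longrightarrow> x \<in> H i \<Longrightarrow> y \<in> H i \<Longrightarrow> x < y \<Longrightarrow> f {x, y} = c"
        unfolding won_def by auto
      \<comment> \<open>Every block after the first now yields a piece of colour \<open>c\<close>
        with \<open>u (h i)\<close> copies. The first block supplies the opening point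
        \<open>y\<close>, taken below \<open>u (h 0)\<close> as the combination requires.\<close>
      obtain y where y: "y \<in> E (h 0)" using E(3)[of 0] by blast
      have HD: "H i \<subseteq> D (h (Suc i))" "H i \<subseteq> X" if "i < p" for i
        using H(1)[OF that] E(1,2)[of "Suc i"] that by auto
      have yD: "y \<in> D (h 0)" "y \<in> X" using y E(1,2)[of 0] by auto
      have lty: "y < x" and fy: "f {y, x} = c" if "i < p" "x \<in> H i" for i x
        using lt[of 0 "Suc i" y x] fc[of 0 "Suc i" y x] yD HD(1)[OF that(1)] that by auto
      have ltH: "x < z" and fH: "f {x, z} = c" if "i < j" "j < p" "x \<in> H i" "z \<in> H j" for i j x z
        using lt[of "Suc i" "Suc j" x z] fc[of "Suc i" "Suc j" x z] HD(1)[of i] HD(1)[of j] that by auto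
      let ?U = "insert y (\<Union>i<p. H i)"
      have "pow_large (Suc b') p ?U"
      proof (rule pow_large_combine[where p = "\<lambda>i. u (h i)"])
        show "finite (H i)" if "i < p" for i using HD(2)[OF that] prems(1) by (rule finite_subset)
        show "\<forall>x\<in>H i. x < u (h (Suc i))" if "Suc i < p" for i
          using H(1)[of i] E(4)[of "Suc i"] that by auto
        show "y < u (h 0)" using E(4)[of 0, OF _ y] by simp
        show "\<forall>x\<in>H i. \<forall>z\<in>H j. x < z" if "i < j" "j < p" for i j using ltH that by blast
        show "\<forall>x\<in>H i. y < x" if "i < p" for i using lty that by blast
      qed (rule H(2))
      moreover have UX: "?U \<subseteq> X" using yD HD(2) by auto
      ultimately have "pow_large (b c) (m c) ?U"
        using pow_large_mono[OF _ mc subset_refl finite_subset[OF UX prems(1)]] b by simp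
      moreover have "f {v, x} = c" if vx: "v \<in> ?U" "x \<in> ?U" "v < x" for v x
      proof -
        from vx(2) consider "x = y" | j where "j < p" "x \<in> H j" by auto
        then show ?thesis
        proof cases
          case 1
          then have "v \<noteq> y" using vx(3) by simp
          with vx(1) obtain i where "i < p" "v \<in> H i" by auto
          then show ?thesis using lty 1 vx(3) by fastforce
        next
          case j: (2 j)
          from vx(1) consider "v = y" | i where "i < p" "v \<in> H i" by auto
          then show ?thesis
          proof cases
            case 1
            then show ?thesis using fy j by simp
          next
            case i: (2 i)
            consider "i < j" | "i = j" | "j < i" by linarith
            then show ?thesis
            proof cases
              case 1
              then show ?thesis using fH i j by blast
            next
              case 2
              then show ?thesis using H(3) i j vx(3) by blast
            next
              case 3
              then show ?thesis using ltH[OF 3 i(1) j(2) i(2)] vx(3) by simp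
            qed
          qed
        qed
      qed
      ultimately show ?thesis using h(1) UX by blast
    qed
  qed
qed

section \<open>Comparison with fundamental sequences\<close>

lemma cnf_of_nat_Suc: "cnf_of_nat (Suc s) = CNF (CNF [] # replicate s (CNF []))"
  by (simp add: cnf_of_nat_def omega_pow_times_def)

lemma cnf_of_nat_replicate: "cnf_of_nat s = CNF (replicate s (CNF []))"
  by (simp add: cnf_of_nat_def omega_pow_times_def)

lemma fund_cnf_of_nat_Suc:
  "fund (CNF (cnf_of_nat (Suc s) # \<delta>)) x = CNF (replicate x (cnf_of_nat s) @ \<delta>)"
  by (simp add: cnf_of_nat_Suc cnf_of_nat_replicate)

lemma cnf_of_nat_0: "cnf_of_nat 0 = CNF []"
  by (simp add: cnf_of_nat_replicate)

text \<open>Fundamental sequences act on the head of the list, the smallest term, so the copies are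
  used up one after another before \<open>\<delta>\<close> is touched. One point \<open>x\<close>
  turns a copy of \<open>\<omega>^(s+1)\<close> into \<open>x\<close> copies of
  \<open>\<omega>^s\<close>: the outer induction on \<open>s\<close> uses these up, the inner one on
  \<open>m\<close> the remaining copies.\<close>

lemma foldl_fund_imp_pow_large:
  assumes "foldl fund (CNF (replicate m (cnf_of_nat s) @ \<delta>)) xs = CNF []" "sorted_wrt (<) xs"
  shows "\<exists>ys zs. xs = ys @ zs \<and> pow_large s m (set ys) \<and> foldl fund (CNF \<delta>) zs = CNF []"
  using assms
proof (induction s arbitrary: m \<delta> xs)
  case 0
  then show ?case
  proof (induction m arbitrary: xs)
    case 0
    then show ?case by (intro exI[of _ "[]"] exI[of _ xs]) simp
  next
    case (Suc m)
    from Suc.prems obtain x xs' where xs: "xs = x # xs'" by (cases xs) auto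
    with Suc.prems have "foldl fund (CNF (replicate m (cnf_of_nat 0) @ \<delta>)) xs' = CNF []"
      "sorted_wrt (<) xs'" by (simp_all add: cnf_of_nat_0)
    from Suc.IH[OF this] obtain ys zs where
      *: "xs' = ys @ zs" "pow_large 0 m (set ys)" "foldl fund (CNF \<delta>) zs = CNF []" by blast
    moreover have "x \<notin> set ys" using Suc.prems(2) xs *(1) by auto
    ultimately show ?case using xs by (intro exI[of _ "x # ys"] exI[of _ zs]) simp
  qed
next
  case (Suc s)
  note IH = Suc.IH
  from Suc.prems show ?case
  proof (induction m arbitrary: xs)
    case 0
    then show ?case by (intro exI[of _ "[]"] exI[of _ xs]) simp
  next
    case (Suc m)
    from Suc.prems obtain x xs' where xs: "xs = x # xs'" by (cases xs) auto
    with Suc.prems have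
      "foldl fund (CNF (replicate x (cnf_of_nat s) @ replicate m (cnf_of_nat (Suc s)) @ \<delta>)) xs' = CNF []"
      "sorted_wrt (<) xs'" by (simp_all add: fund_cnf_of_nat_Suc)
    from IH[OF this] obtain ys zs where *: "xs' = ys @ zs" "pow_large s x (set ys)"
      "foldl fund (CNF (replicate m (cnf_of_nat (Suc s)) @ \<delta>)) zs = CNF []" by blast
    have "sorted_wrt (<) zs" using Suc.prems(2) xs *(1) by (simp add: sorted_wrt_append)
    from Suc.IH[OF *(3) this] obtain ys' zs' where
      **: "zs = ys' @ zs'" "pow_large (Suc s) m (set ys')" "foldl fund (CNF \<delta>) zs' = CNF []" by blast
    have "pow_large (Suc s) (Suc m) (set (x # ys @ ys'))"
      unfolding pow_large.simps(3)
    proof (intro bexI exI conjI)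
      show "pow_large s x (set ys)" "pow_large (Suc s) m (set ys')" by fact+
    qed (use Suc.prems(2) xs *(1) **(1) in \<open>auto simp: sorted_wrt_append\<close>)
    then show ?case using xs *(1) **(1,3) by (intro exI[of _ "x # ys @ ys'"] exI[of _ zs']) simp
  qed
qed

text \<open>Asking for the same \<open>xs\<close> for every \<open>\<delta>\<close> lets runs be
  chained: the run through \<open>Y\<close> is used with the \<open>m\<close> remaining copies as
  part of its tail, and the run through \<open>Z\<close> then removes those.\<close>

lemma pow_large_imp_foldl_fund:
  assumes "pow_large s m X"
  shows "\<exists>xs. sorted_wrt (<) xs \<and> set xs \<subseteq> X \<and>
    (\<forall>\<delta>. foldl fund (CNF (replicate m (cnf_of_nat s) @ \<delta>)) xs = CNF \<delta>)"
  using assms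
proof (induction s m X rule: pow_large.induct)
  case (1 m X)
  then obtain Y where Y: "Y \<subseteq> X" "card Y = m" "finite Y"
    using obtain_subset_with_card_n[of m X] by auto
  have "foldl fund (CNF (replicate (length xs) (cnf_of_nat 0) @ \<delta>)) xs = CNF \<delta>" for xs \<delta>
    by (induction xs) (auto simp: cnf_of_nat_0)
  from this[of "sorted_list_of_set Y"] show ?case
    using Y by (intro exI[of _ "sorted_list_of_set Y"]) simp
next
  case (2 s X)
  show ?case by (intro exI[of _ "[]"]) simp
next
  case (3 s m X)
  from "3.prems" obtain x Y Z where *: "x \<in> X" "Y \<subseteq> X" "Z \<subseteq> X" "\<forall>y\<in>Y. x < y"
    "\<forall>z\<in>Z. x < z" "\<forall>y\<in>Y. \<forall>z\<in>Z. y < z" "pow_large s x Y" "pow_large (Suc s) m Z"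
    using pow_large.simps(3)[of s m X] by blast
  from "3.IH"(1)[OF *(1) *(7)] obtain ys where ys: "sorted_wrt (<) ys" "set ys \<subseteq> Y"
    "\<And>\<delta>. foldl fund (CNF (replicate x (cnf_of_nat s) @ \<delta>)) ys = CNF \<delta>" by blast
  from "3.IH"(2)[OF *(1) *(8)] obtain zs where zs: "sorted_wrt (<) zs" "set zs \<subseteq> Z"
    "\<And>\<delta>. foldl fund (CNF (replicate m (cnf_of_nat (Suc s)) @ \<delta>)) zs = CNF \<delta>" by blast
  have "\<forall>y\<in>set ys. \<forall>z\<in>set zs. y < z" using ys(2) zs(2) *(6) by blast
  then have "sorted_wrt (<) (x # ys @ zs)"
    using ys(1,2) zs(1,2) *(4,5) by (auto simp: sorted_wrt_append)
  moreover have "set (x # ys @ zs) \<subseteq> X" using ys(2) zs(2) *(1-3) by auto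
  moreover have "foldl fund (CNF (replicate (Suc m) (cnf_of_nat (Suc s)) @ \<delta>)) (x # ys @ zs) = CNF \<delta>" for \<delta>
    using ys(3)[of "replicate m (cnf_of_nat (Suc s)) @ \<delta>"] zs(3)[of \<delta>] by (simp add: fund_cnf_of_nat_Suc)
  ultimately show ?case by blast
qed

lemma large_imp_pow_large:
  assumes "large (omega_pow_times (cnf_of_nat s) m) X"
  shows "pow_large s m X"
proof -
  let ?xs = "sorted_list_of_set X"
  have X: "finite X" "foldl fund (CNF (replicate m (cnf_of_nat s) @ [])) ?xs = CNF []"
    using assms by (auto simp: large_def fund_set_def omega_pow_times_def)
  from foldl_fund_imp_pow_large[OF X(2)] obtain ys zs where "?xs = ys @ zs" "pow_large s m (set ys)"
    by auto
  moreover from this(1) have "set ys \<subseteq> X" using X(1) by (metis Un_upper1 set_append set_sorted_list_of_set)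
  ultimately show ?thesis using X(1) pow_large_superset by blast
qed

lemma pow_large_imp_large:
  assumes "pow_large s m X"
  shows "\<exists>H\<subseteq>X. large (omega_pow_times (cnf_of_nat s) m) H"
proof -
  from pow_large_imp_foldl_fund[OF assms] obtain xs where
    xs: "sorted_wrt (<) xs" "set xs \<subseteq> X"
      "foldl fund (CNF (replicate m (cnf_of_nat s) @ [])) xs = CNF []" by blast
  have "sorted_list_of_set (set xs) = xs"
    using xs(1) by (simp add: sorted_list_of_set.idem_if_sorted_distinct strict_sorted_iff)
  then have "large (omega_pow_times (cnf_of_nat s) m) (set xs)"
    using xs(3) by (simp add: large_def fund_set_def omega_pow_times_def)
  with xs(2) show ?thesis by blast
qed

section \<open>Reduction of the theorem to colour-dependent targets\<close>

theorem mainTheorem17: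
  fixes n k :: nat and X :: "nat set" and f :: "nat set \<Rightarrow> nat"
  assumes "n \<ge> 1" and "k \<ge> 1"
    and "finite X"
    and "large (omega_pow_times (cnf_of_nat (k * n)) 4) X"
    and "sparse (\<lambda>x. x ^ ramsey_number x (2 * x + 2)) X"
    and "k * n \<le> Min X"
    and "f \<in> [X]\<^bsup>2\<^esup> \<rightarrow> {..<k}"
  shows "\<exists>H\<subseteq>X. large (omega_pow_times (cnf_of_nat n) 1) H \<and> homogeneous f H"
proof -
  let ?R = "\<lambda>p. ramsey_number k (p + 1)"
  obtain n' where n: "n = Suc n'" using assms(1) by (cases n) auto
  have k: "0 < k" using assms(2) by simp
  \<comment> \<open>\<open>s\<close> is the sum of the exponents once the exponent of a single
    colour has been lowered from \<open>n\<close> to \<open>n'\<close>.\<close>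
  obtain s where s: "k * n = Suc s" using n k by (cases "k * n") auto
  have Xge: "k * n \<le> x" if "x \<in> X" for x
    using assms(6) Min_le[OF assms(3) that] by simp
  have "pow_large (Suc s) 4 X" using large_imp_pow_large[OF assms(4)] s by simp
  from pow_large_blocks[OF this] obtain e :: "nat \<Rightarrow> nat" and F where
    eF: "\<And>j. j < 4 \<Longrightarrow> e j \<in> X \<and> F j \<subseteq> X \<and> (\<forall>y\<in>F j. e j < y) \<and> pow_large s (e j) (F j)"
      "\<And>i j. i < j \<Longrightarrow> j < 4 \<Longrightarrow> e i < e j \<and> (\<forall>y\<in>F i. y < e j)"
    by metis
  \<comment> \<open>Block 0 lies below and forces \<open>2 \<le> x\<close>; block 2 lies above and
    will contain the set to which \<open>pow_large_ramsey\<close> is applied.\<close>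
  define x where "x = e 1"
  have x: "x \<in> X" "2 \<le> x" "k \<le> x" "x < e 2"
  proof -
    have "1 \<le> e 0" using Xge[of "e 0"] eF(1)[of 0] s by simp
    moreover have "e 0 < e 1" "e 1 < e 2" using eF(2) by auto
    moreover have "k \<le> k * n" using n by simp
    moreover have "e 1 \<in> X" using eF(1)[of 1] by simp
    ultimately show "x \<in> X" "2 \<le> x" "k \<le> x" "x < e 2"
      using Xge[of "e 1"] unfolding x_def by linarith+
  qed
  have e2: "e 2 \<in> X" "F 2 \<subseteq> X" "\<And>y. y \<in> F 2 \<Longrightarrow> e 2 < y" "pow_large s (e 2) (F 2)"
    using eF(1)[of 2] by auto
  have fin: "finite (F 2)" using e2(2) assms(3) by (rule finite_subset)
  have fk: "f {u, v} < k" if "u \<in> X" "v \<in> X" "u < v" for u v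
    using assms(7) that by (auto simp: Pi_iff)
  have cube: "u ^ 3 < v" if "u \<in> X" "v \<in> X" "u < v" "x \<le> u" for u v
    using sparse_ramsey_bound(2)[OF assms(5) that(1-3) k _ _ less_le_trans[of 0 x]] x(2,3) that(4) by simp
  \<comment> \<open>Making the colour towards the single point \<open>x\<close> constant costs one
    factor \<open>k\<close> and one copy. The general growth bound at \<open>p = 0\<close> covers
    this.\<close>
  have "k ^ 1 * Suc (Suc (?R x)) \<le> e 2"
  proof -
    have "k ^ 1 * Suc (Suc (?R x)) \<le> k ^ x * (k ^ ?R 0 * (?R x + 3) + 1)"
    proof (rule mult_le_mono)
      show "k ^ 1 \<le> k ^ x" using k x(2) by (intro power_increasing) auto
      have "Suc (Suc (?R x)) \<le> 1 * (?R x + 3)" by simp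
      also have "\<dots> \<le> k ^ ?R 0 * (?R x + 3)" using k by (intro mult_le_mono1) auto
      finally show "Suc (Suc (?R x)) \<le> k ^ ?R 0 * (?R x + 3) + 1" by (rule trans_le_add1)
    qed
    also have "\<dots> \<le> e 2"
      using sparse_ramsey_bound(1)[OF assms(5) x(1) e2(1) x(4) k x(3,2), of 0] x(2) by simp
    finally show ?thesis .
  qed
  then have "pow_large s (k ^ 1 * Suc (Suc (?R x))) (F 2)"
    by (rule pow_large_mono[OF e2(4) _ subset_refl fin])
  then have "\<exists>D\<subseteq>F 2. pow_large s (Suc (?R x)) D \<and> (\<forall>i\<in>{x}. \<forall>y\<in>D. \<forall>z\<in>D. f {i, y} = f {i, z})"
  proof (intro pow_large_thin[where k = k and d = 1 and \<phi> = "\<lambda>i y. f {i, y}"])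
    have F2: "y \<in> X" "x < y" if "y \<in> F 2" for y using e2(2,3) x(4) that by force+
    show "y ^ 3 < z" if "y \<in> F 2" "z \<in> F 2" "y < z" for y z
      using cube[OF F2(1)[OF that(1)] F2(1)[OF that(2)] that(3)] F2(2)[OF that(1)] by simp
    show "2 \<le> y \<and> k ^ 1 \<le> y" if "y \<in> F 2" for y using F2[OF that] x(2,3) by simp
    show "f {i, y} < k" if "i \<in> {x}" "y \<in> F 2" for i y using fk[OF x(1) F2[OF that(2)]] that(1) by simp
  qed (use fin k in simp_all)
  then obtain D where D: "D \<subseteq> F 2" "pow_large s (Suc (?R x)) D"
    "\<And>y z. y \<in> D \<Longrightarrow> z \<in> D \<Longrightarrow> f {x, y} = f {x, z}" by blast
  have DX: "D \<subseteq> X" "\<And>y. y \<in> D \<Longrightarrow> x < y" using D(1) e2(2,3) x(4) by force+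
  obtain z where z: "z \<in> D" using pow_large_nonempty[OF D(2)] by auto
  define c where "c = f {x, z}"
  have c: "c < k" "\<And>y. y \<in> D \<Longrightarrow> f {x, y} = c"
    unfolding c_def using fk[OF x(1) _ DX(2)[OF z]] z DX(1) D(3)[OF _ z] by blast+
  have "\<exists>i<k. \<exists>H\<subseteq>D. pow_large (((\<lambda>_. n)(c := n')) i) (((\<lambda>_. 1)(c := x)) i) H \<and>
      (\<forall>u\<in>H. \<forall>v\<in>H. u < v \<longrightarrow> f {u, v} = i)"
  proof (rule pow_large_ramsey[where p = x and s = s])
    show "finite D" using DX(1) assms(3) by (rule finite_subset)
    show "sparse (\<lambda>x. x ^ ramsey_number x (2 * x + 2)) D"
      using assms(5) DX(1) unfolding sparse_def by blast
    show "f \<in> [D]\<^bsup>2\<^esup> \<rightarrow> {..<k}" using assms(7) nsets_mono[OF DX(1)] by blast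
    show "((\<lambda>_. 1)(c := x)) i \<le> x" for i using x(2) by simp
    \<comment> \<open>This is where the exponent \<open>k * n\<close> comes from: the lowered
      exponents add up to \<open>k * n - 1\<close>, the exponent available inside a block.\<close>
    have "(\<Sum>i<k. ((\<lambda>_. n)(c := n')) i) = n' + (k - 1) * n"
      using c(1) by (simp add: sum.remove[of "{..<k}" c])
    then have "Suc (\<Sum>i<k. ((\<lambda>_. n)(c := n')) i) = k * n"
      using n k by (cases k) auto
    then show "(\<Sum>i<k. ((\<lambda>_. n)(c := n')) i) = s" using s by simp
  qed (fact DX(2) x(3) k D(2))+
  then obtain i H where H: "i < k" "H \<subseteq> D"
    "pow_large (((\<lambda>_. n)(c := n')) i) (((\<lambda>_. 1)(c := x)) i) H"
    "\<And>u v. u \<in> H \<Longrightarrow> v \<in> H \<Longrightarrow> u < v \<Longrightarrow> f {u, v} = i" by blast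
  have "\<exists>K\<subseteq>X. pow_large n 1 K \<and> homogeneous f K"
  proof (cases "i = c")
    case True
    \<comment> \<open>\<open>x\<close> opens one copy of \<open>\<omega>^n\<close> with
      \<open>H\<close>, which holds \<open>x\<close> copies of \<open>\<omega>^n'\<close>, as its
      block and nothing after it.\<close>
    have "pow_large (Suc n') (Suc 0) (insert x H)"
      unfolding pow_large.simps(3)
      using H(2,3) True DX(2) by (intro bexI[of _ x] exI[of _ H] exI[of _ "{}"] conjI) auto
    moreover have "homogeneous f (insert x H)"
    proof (rule homogeneousI)
      fix u v assume uv: "u \<in> insert x H" "v \<in> insert x H" "u < v"
      then have "v \<in> H" using H(2) DX(2) by force
      then show "f {u, v} = c" using uv H(4)[of u v] c(2)[of v] H(2) True by blast
    qed
    ultimately show ?thesis using n H(2) DX(1) x(1)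
      by (intro exI[of _ "insert x H"]) auto
  next
    case False
    then have "pow_large n 1 H" using H(3) by simp
    moreover have "homogeneous f H" using H(4) by (rule homogeneousI)
    moreover have "H \<subseteq> X" using H(2) DX(1) by blast
    ultimately show ?thesis by blast
  qed
  then obtain K where K: "K \<subseteq> X" "pow_large n 1 K" "homogeneous f K" by blast
  from pow_large_imp_large[OF K(2)] obtain H' where
    "H' \<subseteq> K" "large (omega_pow_times (cnf_of_nat n) 1) H'" by blast
  then show ?thesis using K(1,3) homogeneous_subset by blast
qed

end
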